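(* Let $F$ be a function field of genus $g$ over $\mathbb{F}_q$ of characteristic $p$, let $P_1,\dots,P_n$ be pairwise distinct rational places of $F$, $D=P_1+\cdots+P_n$, and let $G$ be a divisor with support disjoint from that of $D$. Let $1\le s\le\ell$ and $e\ge 0$ be integers. Then the inseparable Guruswami–Sudan list-decoder for $C_L(D,G)$ with multiplicity parameter $s$, designed list size $\ell$ and exponent $e$ has list-decoding radius at least \[\frac{s(2\ell-s+1)n-\ell(\ell+1)\deg G}{2s(\ell+1)}-\frac{1+g\ell}{p^es(\ell+1)}.\] In particular, choosing $e=\lceil\log_p(1+g\ell)\rceil$, one obtains a list-decoder with list-decoding radius at least \[\frac{s(2\ell-s+1)n-\ell(\ell+1)\deg G-2}{2s(\ell+1)}.\]
   Context: $F$ has full constant field $\mathbb{F}_q$. For a divisor $A$, $L(A)=\{h\in F\setminus\{0\}\mid (h)+A\ge 0\}\cup\{0\}$. The AG code is $C_L(D,G)=\{(f(P_1),\dots,f(P_n))\mid f\in L(G)\}\subseteq\mathbb{F}_q^n$. Multiplicity: for a rational place $P$, $r\in\mathbb{F}_q$ and $Q(z)\in F[z]$, $(P,r)$ is a zero of $Q$ with multiplicity at least $m$ if, for a local parameter $\phi$ of $P$, $Q(z)=\sum_{a,b\ge0,\ a+b\ge m}c_{a,b}\phi^a(z-r)^b$ with $c_{a,b}\in\mathbb{F}_q$ (power series expansion at $P$). Inseparable Guruswami–Sudan list-decoder with parameters $s,\ell$ and exponent $e$, for a target number of errors $\tau$ (an integer, $0\le\tau\le n$): fix any divisor $A$ with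 support disjoint from that of $D$ and $\deg A=p^es(n-\tau)-1$. On input $\mathbf r=(r_1,\dots,r_n)\in\mathbb{F}_q^n$, find a nonzero polynomial $Q(z)=\sum_{j=0}^{\ell}Q_jz^{p^ej}\in F[z]$ with $Q_j\in L(A-p^ejG)$ for $j=0,\dots,\ell$ and such that each $(P_i,r_i)$, $i=1,\dots,n$, is a zero of $Q(z)$ with multiplicity at least $p^es$. If no such $Q$ exists, return the empty list; otherwise return all $f\in L(G)$ with $Q(f)=0$ and with $(f(P_1),\dots,f(P_n))$ at Hamming distance at most $\tau$ from $\mathbf r$. The list-decoder is said to have list-decoding radius at least a real number $X$ if for every integer $\tau$ with $0\le\tau\le n$ and $\tau\le X$, and every $\mathbf r\in\mathbb{F}_q^n$, the decoder with target $\tau$ (for any admissible choice of $A$ and $Q$) returns exactly the set of all $f\in L(G)$ whose codeword $(f(P_1),\dots,f(P_n))$ has Hamming distance at most $\tau$ from $\mathbf r$, this set having at most $\ell$ elements. *)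

theory Defs
  imports Complex_Main "HOL-Computational_Algebra.Polynomial" "HOL-Library.Poly_Mapping"
begin

section \<open>Algebraic function fields of one variable over a finite field\<close>

text \<open>
  The constant field \<open>K\<close> is the finite field type \<open>'q\<close>, the function field \<open>F\<close> is the field type
  \<open>'f\<close>, and \<open>\<iota>\<close> is the embedding of \<open>K\<close> into \<open>F\<close>.
\<close>

definition algebraic_over_constants :: "('q::field \<Rightarrow> 'f::field) \<Rightarrow> 'f \<Rightarrow> bool" where
  "algebraic_over_constants \<iota> z \<longleftrightarrow> (\<exists>a :: 'q poly. a \<noteq> 0 \<and> poly (map_poly \<iota> a) z = 0)"

definition rational_subfield :: "('q::field \<Rightarrow> 'f::field) \<Rightarrow> 'f \<Rightarrow> 'f set" where
  "rational_subfield \<iota> x =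
     {poly (map_poly \<iota> a) x / poly (map_poly \<iota> b) x | a b. poly (map_poly \<iota> b) x \<noteq> 0}"

locale function_field =
  fixes \<iota> :: "'q::{field,finite} \<Rightarrow> 'f::field"
  assumes embed_one: "\<iota> 1 = 1"
    and embed_add: "\<iota> (a + b) = \<iota> a + \<iota> b"
    and embed_mult: "\<iota> (a * b) = \<iota> a * \<iota> b"
    and finite_over_rational:
      "\<exists>x. \<not> algebraic_over_constants \<iota> x \<and>
           (\<exists>B. finite B \<and> (\<forall>z. \<exists>c. (\<forall>b\<in>B. c b \<in> rational_subfield \<iota> x) \<and> z = (\<Sum>b\<in>B. c b * b)))"

definition full_constant_field :: "('q::field \<Rightarrow> 'f::field) \<Rightarrow> bool" where
  "full_constant_field \<iota> \<longleftrightarrow> (\<forall>z. algebraic_over_constants \<iota> z \<longrightarrow> z \<in> range \<iota>)"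


section \<open>Places and valuations\<close>

definition valuation_ring :: "('q::field \<Rightarrow> 'f::field) \<Rightarrow> 'f set \<Rightarrow> bool" where
  "valuation_ring \<iota> R \<longleftrightarrow>
     (\<forall>x\<in>R. \<forall>y\<in>R. x - y \<in> R \<and> x * y \<in> R) \<and>
     range \<iota> \<subset> R \<and> R \<subset> UNIV \<and>
     (\<forall>z. z \<in> R \<or> inverse z \<in> R)"

text \<open>
  A valuation ring is local, and its maximal ideal consists of its non-units. A place is
  such a maximal ideal. (In HOL \<open>inverse 0 = 0\<close>, so zero is treated separately.)
\<close>

definition place :: "('q::field \<Rightarrow> 'f::field) \<Rightarrow> 'f set \<Rightarrow> bool" where
  "place \<iota> P \<longleftrightarrow> (\<exists>R. valuation_ring \<iota> R \<and> P = {z \<in> R. z = 0 \<or> inverse z \<notin> R})"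

text \<open>The valuation ring \<open>O\<^sub>P\<close> is determined by its maximal ideal \<open>P\<close>.\<close>

definition ring_of_place :: "'f::field set \<Rightarrow> 'f set" where
  "ring_of_place P = {z. z = 0 \<or> inverse z \<notin> P}"

definition local_parameter :: "'f::field set \<Rightarrow> 'f \<Rightarrow> bool" where
  "local_parameter P t \<longleftrightarrow> P = {t * w | w. w \<in> ring_of_place P}"

text \<open>
  The normalised discrete valuation \<open>v\<^sub>P\<close> at a nonzero element \<open>z = t\<^sup>k u\<close>, with \<open>t\<close> a local
  parameter and \<open>u\<close> a unit of \<open>O\<^sub>P\<close>. Its value at zero is irrelevant: the predicate
  \<open>valuation_ge\<close> implements \<open>v\<^sub>P(0) = \<infinity>\<close>.
\<close>

definition valuation :: "'f::field set \<Rightarrow> 'f \<Rightarrow> int" where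
  "valuation P z =
     (THE k. \<exists>t u. local_parameter P t \<and> u \<in> ring_of_place P - P \<and> z = t powi k * u)"

definition valuation_ge :: "'f::field set \<Rightarrow> 'f \<Rightarrow> int \<Rightarrow> bool" where
  "valuation_ge P z k \<longleftrightarrow> z = 0 \<or> valuation P z \<ge> k"

text \<open>The residue classes of the elements of \<open>B\<close> form a \<open>K\<close>-basis of the residue field \<open>O\<^sub>P/P\<close>.\<close>

definition residue_basis :: "('q::field \<Rightarrow> 'f::field) \<Rightarrow> 'f set \<Rightarrow> 'f set \<Rightarrow> bool" where
  "residue_basis \<iota> P B \<longleftrightarrow> finite B \<and> B \<subseteq> ring_of_place P \<and>
     (\<forall>z\<in>ring_of_place P. \<exists>!c. (\<forall>b. b \<notin> B \<longrightarrow> c b = 0) \<and> z - (\<Sum>b\<in>B. \<iota> (c b) * b) \<in> P)"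

definition place_degree :: "('q::field \<Rightarrow> 'f::field) \<Rightarrow> 'f set \<Rightarrow> nat" where
  "place_degree \<iota> P = (THE d. \<exists>B. residue_basis \<iota> P B \<and> d = card B)"

definition rational_place :: "('q::field \<Rightarrow> 'f::field) \<Rightarrow> 'f set \<Rightarrow> bool" where
  "rational_place \<iota> P \<longleftrightarrow> place \<iota> P \<and> place_degree \<iota> P = 1"

text \<open>The residue class \<open>f(P)\<close>, for a rational place \<open>P\<close> and \<open>f \<in> O\<^sub>P\<close>, as an element of \<open>K\<close>.\<close>

definition place_eval :: "('q::field \<Rightarrow> 'f::field) \<Rightarrow> 'f set \<Rightarrow> 'f \<Rightarrow> 'q" where
  "place_eval \<iota> P f = (THE a. f - \<iota> a \<in> P)"


section \<open>Divisors, Riemann--Roch spaces and the genus\<close>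

text \<open>Divisors are elements of the free abelian group on the places.\<close>

definition divisor :: "('q::field \<Rightarrow> 'f::field) \<Rightarrow> ('f set \<Rightarrow>\<^sub>0 int) \<Rightarrow> bool" where
  "divisor \<iota> A \<longleftrightarrow> (\<forall>P\<in>Poly_Mapping.keys A. place \<iota> P)"

definition divisor_degree :: "('q::field \<Rightarrow> 'f::field) \<Rightarrow> ('f set \<Rightarrow>\<^sub>0 int) \<Rightarrow> int" where
  "divisor_degree \<iota> A =
     (\<Sum>P\<in>Poly_Mapping.keys A. Poly_Mapping.lookup A P * int (place_degree \<iota> P))"

definition riemann_roch_space :: "('q::field \<Rightarrow> 'f::field) \<Rightarrow> ('f set \<Rightarrow>\<^sub>0 int) \<Rightarrow> 'f set" where
  "riemann_roch_space \<iota> A =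
     {h. \<forall>P. place \<iota> P \<longrightarrow> valuation_ge P h (- Poly_Mapping.lookup A P)}"

definition riemann_roch_dim :: "('q::field \<Rightarrow> 'f::field) \<Rightarrow> ('f set \<Rightarrow>\<^sub>0 int) \<Rightarrow> nat" where
  "riemann_roch_dim \<iota> A = vector_space.dim (\<lambda>a z. \<iota> a * z) (riemann_roch_space \<iota> A)"

text \<open>The genus is the maximum of \<open>deg A - dim L(A) + 1\<close> over all divisors \<open>A\<close>.\<close>

definition has_genus :: "('q::field \<Rightarrow> 'f::field) \<Rightarrow> nat \<Rightarrow> bool" where
  "has_genus \<iota> g \<longleftrightarrow>
     (\<exists>A. divisor \<iota> A \<and> divisor_degree \<iota> A - int (riemann_roch_dim \<iota> A) + 1 = int g) \<and>
     (\<forall>A. divisor \<iota> A \<longrightarrow> divisor_degree \<iota> A - int (riemann_roch_dim \<iota> A) + 1 \<le> int g)"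


section \<open>Zeros of polynomials with multiplicity\<close>

text \<open>The series \<open>\<Sum>c\<^sub>a \<phi>\<^sup>a\<close> converges to \<open>u\<close> with respect to the valuation at \<open>P\<close>.\<close>

definition power_expansion ::
  "('q::field \<Rightarrow> 'f::field) \<Rightarrow> 'f set \<Rightarrow> 'f \<Rightarrow> (nat \<Rightarrow> 'q) \<Rightarrow> 'f \<Rightarrow> bool" where
  "power_expansion \<iota> P \<phi> c u \<longleftrightarrow>
     (\<forall>k. \<forall>\<^sub>F N in sequentially. valuation_ge P (u - (\<Sum>a<N. \<iota> (c a) * \<phi> ^ a)) k)"

text \<open>
  \<open>Q(z) = \<Sum> c\<^sub>a\<^sub>b \<phi>\<^sup>a (z - r)\<^sup>b\<close> over all \<open>a + b \<ge> m\<close>: the coefficient of \<open>(z - r)\<^sup>b\<close> in \<open>Q\<close>,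
  that is, of \<open>z\<^sup>b\<close> in \<open>Q(z + r)\<close>, has the expansion \<open>\<Sum>c\<^sub>a\<^sub>b \<phi>\<^sup>a\<close> at \<open>P\<close>.
\<close>

definition zero_with_multiplicity_ge ::
  "('q::field \<Rightarrow> 'f::field) \<Rightarrow> 'f set \<Rightarrow> 'q \<Rightarrow> 'f poly \<Rightarrow> nat \<Rightarrow> bool" where
  "zero_with_multiplicity_ge \<iota> P r Q m \<longleftrightarrow>
     (\<exists>\<phi> c. local_parameter P \<phi> \<and>
        (\<forall>a b. a + b < m \<longrightarrow> c a b = 0) \<and>
        (\<forall>b. power_expansion \<iota> P \<phi> (\<lambda>a. c a b) (coeff (pcompose Q [:\<iota> r, 1:]) b)))"


section \<open>The inseparable Guruswami--Sudan list-decoder\<close>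

text \<open>
  The evaluation places \<open>P\<^sub>1, \<dots>, P\<^sub>n\<close> are given as a list \<open>Ps\<close>, and words in \<open>K\<^sup>n\<close> are lists of
  length \<open>n\<close>.
\<close>

definition sum_of_places :: "'f set list \<Rightarrow> ('f set \<Rightarrow>\<^sub>0 int)" where
  "sum_of_places Ps = (\<Sum>P\<leftarrow>Ps. frag_of P)"

definition disjoint_support :: "('f set \<Rightarrow>\<^sub>0 int) \<Rightarrow> ('f set \<Rightarrow>\<^sub>0 int) \<Rightarrow> bool" where
  "disjoint_support A B \<longleftrightarrow> Poly_Mapping.keys A \<inter> Poly_Mapping.keys B = {}"

definition codeword :: "('q::field \<Rightarrow> 'f::field) \<Rightarrow> 'f set list \<Rightarrow> 'f \<Rightarrow> 'q list" where
  "codeword \<iota> Ps f = map (\<lambda>P. place_eval \<iota> P f) Ps"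

definition hamming_distance :: "'q list \<Rightarrow> 'q list \<Rightarrow> nat" where
  "hamming_distance xs ys = card {i. i < length xs \<and> xs ! i \<noteq> ys ! i}"

definition close_functions ::
  "('q::field \<Rightarrow> 'f::field) \<Rightarrow> 'f set list \<Rightarrow> ('f set \<Rightarrow>\<^sub>0 int) \<Rightarrow> nat \<Rightarrow> 'q list \<Rightarrow> 'f set" where
  "close_functions \<iota> Ps G \<tau> r =
     {f \<in> riemann_roch_space \<iota> G. hamming_distance (codeword \<iota> Ps f) r \<le> \<tau>}"

definition admissible_divisor ::
  "('q::field \<Rightarrow> 'f::field) \<Rightarrow> 'f set list \<Rightarrow> nat \<Rightarrow> nat \<Rightarrow> nat \<Rightarrow> ('f set \<Rightarrow>\<^sub>0 int) \<Rightarrow> bool" where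
  "admissible_divisor \<iota> Ps s e \<tau> A \<longleftrightarrow>
     divisor \<iota> A \<and> disjoint_support A (sum_of_places Ps) \<and>
     divisor_degree \<iota> A = int (CHAR('q) ^ e) * int s * (int (length Ps) - int \<tau>) - 1"

definition interpolation_polynomial ::
  "('q::field \<Rightarrow> 'f::field) \<Rightarrow> 'f set list \<Rightarrow> ('f set \<Rightarrow>\<^sub>0 int) \<Rightarrow> nat \<Rightarrow> nat \<Rightarrow> nat \<Rightarrow>
   ('f set \<Rightarrow>\<^sub>0 int) \<Rightarrow> 'q list \<Rightarrow> 'f poly \<Rightarrow> bool" where
  "interpolation_polynomial \<iota> Ps G s l e A r Q \<longleftrightarrow>
     Q \<noteq> 0 \<and>
     (\<exists>Qc. Q = (\<Sum>j\<le>l. monom (Qc j) (CHAR('q) ^ e * j)) \<and>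
           (\<forall>j\<le>l. Qc j \<in> riemann_roch_space \<iota> (A - frag_cmul (int (CHAR('q) ^ e * j)) G))) \<and>
     (\<forall>i<length Ps. zero_with_multiplicity_ge \<iota> (Ps ! i) (r ! i) Q (CHAR('q) ^ e * s))"

text \<open>
  The decoder may use any interpolation polynomial, so it is modelled as the relation between
  its input \<open>r\<close> and its possible outputs \<open>S\<close>.
\<close>

definition decoder_output ::
  "('q::field \<Rightarrow> 'f::field) \<Rightarrow> 'f set list \<Rightarrow> ('f set \<Rightarrow>\<^sub>0 int) \<Rightarrow> nat \<Rightarrow> nat \<Rightarrow> nat \<Rightarrow>
   nat \<Rightarrow> ('f set \<Rightarrow>\<^sub>0 int) \<Rightarrow> 'q list \<Rightarrow> 'f set \<Rightarrow> bool" where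
  "decoder_output \<iota> Ps G s l e \<tau> A r S \<longleftrightarrow>
     (if \<exists>Q. interpolation_polynomial \<iota> Ps G s l e A r Q
      then \<exists>Q. interpolation_polynomial \<iota> Ps G s l e A r Q \<and>
               S = {f \<in> close_functions \<iota> Ps G \<tau> r. poly Q f = 0}
      else S = {})"

definition list_decoding_radius_ge ::
  "('q::field \<Rightarrow> 'f::field) \<Rightarrow> 'f set list \<Rightarrow> ('f set \<Rightarrow>\<^sub>0 int) \<Rightarrow> nat \<Rightarrow> nat \<Rightarrow> nat \<Rightarrow> real \<Rightarrow> bool" where
  "list_decoding_radius_ge \<iota> Ps G s l e X \<longleftrightarrow>
     (\<forall>\<tau>::nat. \<tau> \<le> length Ps \<longrightarrow> real \<tau> \<le> X \<longrightarrow>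
        (\<forall>r A S. length r = length Ps \<longrightarrow> admissible_divisor \<iota> Ps s e \<tau> A \<longrightarrow>
                 decoder_output \<iota> Ps G s l e \<tau> A r S \<longrightarrow>
                 S = close_functions \<iota> Ps G \<tau> r \<and> finite S \<and> card S \<le> l))"

end

theory Submission
  imports Defs "HOL-Computational_Algebra.Primes" "HOL-Library.FuncSet"
begin

text \<open>
  With \<open>q = p\<^sup>e\<close>, an interpolation polynomial \<open>Q\<close> is only needed when some \<open>f \<in> L(G)\<close> is close
  to the received word. It is then sought in the form \<open>\<Sum>\<^bsub>1\<le>j\<le>l\<^esub> h\<^sub>j (z - f)\<^bsup>qj\<^esup>\<close> with
  \<open>h\<^sub>j \<in> L(A - qjG)\<close>. Dropping \<open>j = 0\<close> costs only \<open>gl\<close> instead of \<open>g(l + 1)\<close> in the dimension count.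
  At an error position the multiplicity requirement takes \<open>qs(s + 1)/2\<close> linear conditions, because
  shifted by \<open>r\<^sub>i\<close> the polynomial is still one in \<open>z\<^sup>q\<close>; at an error-free position \<open>z - f\<close> already
  vanishes, and \<open>v(h\<^sub>j) \<ge> q(s - j)\<close> for \<open>1 \<le> j < s\<close>, that is \<open>qs(s - 1)/2\<close> conditions, suffices.
  Since the constant field is finite, linear algebra reduces to the pigeonhole principle.

  Conversely, \<open>Q(f) \<in> L(A)\<close> has zeros of order \<open>qs\<close> at the error-free positions, so it lies in a
  Riemann--Roch space of negative degree and vanishes. The list has at most \<open>l\<close> elements since \<open>Q\<close> has
  degree at most \<open>l\<close> in \<open>z\<^sup>q\<close> and the Frobenius map is injective.
\<close>

text \<open>Why \<open>j = 0\<close> may be dropped: every interpolation polynomial is a polynomial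
  in z^q and so expands in powers of (z - f)^q, with constant term Q(f). By the converse direction
  Q(f) = 0 as soon as f is close to the received word, so the restricted form loses no candidate.
  Building Q around a close f is legitimate because a decoder that finds no Q returns the empty
  list, which is wrong only if such an f exists.

  The obstacle is the foundation. \<open>function_field\<close> gives finiteness of F over K(y) for
  a single y, while valuations and place degrees are \<open>THE\<close>-terms over arbitrary
  valuation rings. Discreteness of places and finiteness of residue fields both come from one
  counting statement: for each x there is an M such that any M elements of F are dependent over
  K[x]. Riemann's inequality is contained in the definition of the genus, and the vanishing of L(B)
  for deg B < 0 is deduced from it.\<close>

context function_field
begin

section \<open>The constant field inside F and evaluation of polynomials over it\<close>

lemma embed_zero [simp]: "\<iota> 0 = 0"
  using embed_add[of 0 0] by (metis add_cancel_right_right)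

lemma embed_uminus: "\<iota> (- a) = - \<iota> a"
  using embed_add[of a "- a"] by (simp add: minus_unique)

lemma embed_diff: "\<iota> (a - b) = \<iota> a - \<iota> b"
  using embed_add[of a "- b"] by (simp add: embed_uminus)

lemma embed_sum: "\<iota> (sum f A) = (\<Sum>a\<in>A. \<iota> (f a))"
  by (induction A rule: infinite_finite_induct) (simp_all add: embed_add)

lemma embed_eq_0_iff [simp]: "\<iota> a = 0 \<longleftrightarrow> a = 0"
proof
  assume "\<iota> a = 0"
  show "a = 0"
  proof (rule ccontr)
    assume "a \<noteq> 0"
    then have "\<iota> a * \<iota> (inverse a) = 1" by (simp flip: embed_mult add: embed_one)
    then show False using \<open>\<iota> a = 0\<close> by simp
  qed
qed simp

lemma embed_inverse: "\<iota> (inverse a) = inverse (\<iota> a)"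
proof (cases "a = 0")
  case False
  then have "\<iota> a * \<iota> (inverse a) = 1" by (simp flip: embed_mult add: embed_one)
  then show ?thesis by (metis inverse_unique)
qed simp

lemma embed_of_nat: "\<iota> (of_nat k) = of_nat k"
  by (induction k) (simp_all add: embed_add embed_one)

abbreviation const_poly_eval :: "'q poly \<Rightarrow> 'f \<Rightarrow> 'f" where
  "const_poly_eval a x \<equiv> poly (map_poly \<iota> a) x"

lemma map_poly_embed_add: "map_poly \<iota> (a + b) = map_poly \<iota> a + map_poly \<iota> b"
  by (rule poly_eqI) (simp add: coeff_map_poly embed_add)

lemma map_poly_embed_mult: "map_poly \<iota> (a * b) = map_poly \<iota> a * map_poly \<iota> b"
  by (rule poly_eqI) (simp add: coeff_map_poly coeff_mult embed_sum embed_mult)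

lemma map_poly_embed_sum: "map_poly \<iota> (sum f A) = (\<Sum>a\<in>A. map_poly \<iota> (f a))"
  by (induction A rule: infinite_finite_induct) (simp_all add: map_poly_embed_add)

lemma map_poly_embed_monom: "map_poly \<iota> (monom a k) = monom (\<iota> a) k"
  by (rule poly_eqI) (simp add: coeff_map_poly)

lemma map_poly_embed_one: "map_poly \<iota> 1 = 1"
  by (simp add: one_pCons map_poly_pCons embed_one)

lemma map_poly_embed_prod: "map_poly \<iota> (prod f A) = (\<Prod>a\<in>A. map_poly \<iota> (f a))"
  by (induction A rule: infinite_finite_induct)
     (simp_all add: map_poly_embed_mult map_poly_embed_one)

lemma degree_map_poly_embed: "degree (map_poly \<iota> a) = degree a"
  by (rule degree_map_poly) simp

lemma const_poly_eval_altdef: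
  "const_poly_eval a x = (\<Sum>i\<le>degree a. \<iota> (coeff a i) * x ^ i)"
  by (simp add: poly_altdef degree_map_poly_embed coeff_map_poly)

subsection \<open>Linear dependence over the subring generated by one element\<close>

text \<open>\<open>M\<close> depends on \<open>x\<close> alone. After clearing denominators,
  combinations of the \<open>z i\<close> with polynomial coefficients of degree at most k fall into
  a finite set of size at most |K|^(card B * C0 * k + const), while there are |K|^(M * (k + 1))
  coefficient tuples. With \<open>M\<close> above card B * C0 and k large, two tuples collide, and
  their difference is the relation. The \<open>c i\<close> are polynomials rather than values, so
  algebraic \<open>x\<close> needs no separate case.\<close>

lemma exists_dependence:
  "\<exists>M. \<forall>z :: nat \<Rightarrow> 'f. \<exists>c. (\<exists>i<M. c i \<noteq> 0) \<and> (\<Sum>i<M. const_poly_eval (c i) x * z i) = 0"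
proof -
  obtain y B where ytr: "\<not> algebraic_over_constants \<iota> y" and fB: "finite B"
    and span: "\<And>z. \<exists>c. (\<forall>b\<in>B. c b \<in> rational_subfield \<iota> y) \<and> z = (\<Sum>b\<in>B. c b * b)"
    using finite_over_rational by blast
  \<comment> \<open>A filtration by finite K-spaces: combinations of \<open>B\<close> whose
    coefficients are polynomials in \<open>y\<close> of degree at most \<open>k\<close>. Degrees are
    bounded so that these sets can be counted.\<close>
  define W where "W k = range (\<lambda>a. \<Sum>b\<in>B. (\<Sum>i\<le>k. \<iota> (a b i) * y ^ i) * b)" for k :: nat
  have W_add: "u + v \<in> W k" if uv: "u \<in> W k" "v \<in> W k" for u v k
  proof -
    obtain a a' where "u = (\<Sum>b\<in>B. (\<Sum>i\<le>k. \<iota> (a b i) * y ^ i) * b)"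
       "v = (\<Sum>b\<in>B. (\<Sum>i\<le>k. \<iota> (a' b i) * y ^ i) * b)"
      using uv by (auto simp: W_def)
    then have "u + v = (\<Sum>b\<in>B. (\<Sum>i\<le>k. \<iota> (a b i + a' b i) * y ^ i) * b)"
      by (simp add: sum.distrib ring_distribs embed_add)
    then show ?thesis unfolding W_def by (intro range_eqI[where x="\<lambda>b i. a b i + a' b i"]) auto
  qed
  have W_zero: "0 \<in> W k" for k
    unfolding W_def by (intro range_eqI[where x="\<lambda>b i. 0"]) auto
  have W_sum: "(\<forall>i\<in>I. f i \<in> W k) \<Longrightarrow> sum f I \<in> W k" for f and I :: "'i set" and k
    by (induction I rule: infinite_finite_induct) (auto simp: W_zero intro: W_add)
  have W_scale: "\<iota> c * u \<in> W k" if u: "u \<in> W k" for c u k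
  proof -
    obtain a where "u = (\<Sum>b\<in>B. (\<Sum>i\<le>k. \<iota> (a b i) * y ^ i) * b)"
      using u by (auto simp: W_def)
    then have "\<iota> c * u = (\<Sum>b\<in>B. (\<Sum>i\<le>k. \<iota> (c * a b i) * y ^ i) * b)"
      by (simp add: sum_distrib_left sum_distrib_right embed_mult mult_ac)
    then show ?thesis unfolding W_def by (intro range_eqI[where x="\<lambda>b i. c * a b i"]) auto
  qed
  have W_mono1: "W k \<subseteq> W (Suc k)" for k
  proof
    fix u assume "u \<in> W k"
    then obtain a where "u = (\<Sum>b\<in>B. (\<Sum>i\<le>k. \<iota> (a b i) * y ^ i) * b)"
      by (auto simp: W_def)
    moreover have "(\<Sum>i\<le>Suc k. \<iota> (if i \<le> k then a b i else 0) * y ^ i) = (\<Sum>i\<le>k. \<iota> (a b i) * y ^ i)" for b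
      by simp
    ultimately show "u \<in> W (Suc k)"
      unfolding W_def by (intro range_eqI[where x="\<lambda>b i. if i \<le> k then a b i else 0"]) presburger
  qed
  have W_mono: "u \<in> W k'" if "k \<le> k'" "u \<in> W k" for u k k'
    using lift_Suc_mono_le[of W, OF W_mono1 that(1)] that(2) by blast
  have W_y: "y * u \<in> W (Suc k)" if u: "u \<in> W k" for u k
  proof -
    obtain a where "u = (\<Sum>b\<in>B. (\<Sum>i\<le>k. \<iota> (a b i) * y ^ i) * b)"
      using u by (auto simp: W_def)
    then have "y * u = (\<Sum>b\<in>B. (y * (\<Sum>i\<le>k. \<iota> (a b i) * y ^ i)) * b)"
      by (simp add: sum_distrib_left[of y _ B] mult.assoc)
    moreover have "(\<Sum>i\<le>Suc k. \<iota> (case i of 0 \<Rightarrow> 0 | Suc j \<Rightarrow> a b j) * y ^ i)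
        = y * (\<Sum>i\<le>k. \<iota> (a b i) * y ^ i)" for b
      by (subst sum.atMost_Suc_shift) (simp add: sum_distrib_left mult_ac)
    ultimately show ?thesis unfolding W_def
      by (intro range_eqI[where x="\<lambda>b i. case i of 0 \<Rightarrow> 0 | Suc j \<Rightarrow> a b j"])
         (simp del: sum.atMost_Suc)
  qed
  have W_ypow: "y ^ i * u \<in> W (k + i)" if "u \<in> W k" for u k i
    using that by (induction i) (auto simp: mult.assoc intro: W_y)
  have W_poly: "const_poly_eval a y * u \<in> W (k + D)" if u: "u \<in> W k" and D: "degree a \<le> D" for a u k D
  proof -
    have "const_poly_eval a y * u = (\<Sum>i\<le>degree a. \<iota> (coeff a i) * (y ^ i * u))"
      by (simp add: const_poly_eval_altdef sum_distrib_right mult.assoc)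
    also have "\<dots> \<in> W (k + D)"
      using D by (intro W_sum ballI W_scale W_mono[OF _ W_ypow[OF u]]) auto
    finally show ?thesis .
  qed
  have W_base: "b \<in> W 0" if b: "b \<in> B" for b
  proof -
    have "(\<Sum>b'\<in>B. (\<Sum>i\<le>0. \<iota> (if b' = b then 1 else 0) * y ^ i) * b') = (\<Sum>b'\<in>B. if b' = b then b' else 0)"
      by (intro sum.cong) (auto simp: embed_one)
    also have "\<dots> = b" using b fB by simp
    finally show ?thesis unfolding W_def
      by (intro range_eqI[where x="\<lambda>b' i. if b' = b then 1 else 0"]) simp
  qed
  have denom: "\<exists>d k. const_poly_eval d y \<noteq> 0 \<and> const_poly_eval d y * z \<in> W k" for z
  proof -
    obtain c where c: "\<And>b. b \<in> B \<Longrightarrow> c b \<in> rational_subfield \<iota> y" and z: "z = (\<Sum>b\<in>B. c b * b)"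
      using span[of z] by blast
    have "\<forall>b\<in>B. \<exists>\<alpha> \<beta>. c b = const_poly_eval \<alpha> y / const_poly_eval \<beta> y \<and> const_poly_eval \<beta> y \<noteq> 0"
      using c unfolding rational_subfield_def by blast
    then obtain \<alpha> \<beta> where ab: "\<And>b. b \<in> B \<Longrightarrow> c b = const_poly_eval (\<alpha> b) y / const_poly_eval (\<beta> b) y"
      "\<And>b. b \<in> B \<Longrightarrow> const_poly_eval (\<beta> b) y \<noteq> 0"
      by metis
    define d where "d = prod \<beta> B"
    define \<gamma> where "\<gamma> b = \<alpha> b * prod \<beta> (B - {b})" for b
    define k where "k = (\<Sum>b\<in>B. degree (\<gamma> b))"
    have d: "const_poly_eval d y = (\<Prod>b\<in>B. const_poly_eval (\<beta> b) y)"
      by (simp add: d_def map_poly_embed_prod poly_prod)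
    have "const_poly_eval d y * c b = const_poly_eval (\<gamma> b) y" if b: "b \<in> B" for b
      using ab[OF b] fB b
      by (simp add: d \<gamma>_def map_poly_embed_mult map_poly_embed_prod poly_prod prod.remove)
    then have "const_poly_eval d y * z = (\<Sum>b\<in>B. const_poly_eval (\<gamma> b) y * b)"
      by (simp add: z sum_distrib_left mult.assoc[symmetric])
    also have "\<dots> \<in> W k"
    proof (intro W_sum ballI)
      fix b assume b: "b \<in> B"
      have "degree (\<gamma> b) \<le> k" unfolding k_def using fB b by (intro member_le_sum) auto
      from W_poly[OF W_base[OF b] this] show "const_poly_eval (\<gamma> b) y * b \<in> W k" by simp
    qed
    finally show ?thesis using ab(2) fB by (intro exI[of _ d]) (auto simp: d)
  qed
  have denoms: "\<exists>d k. const_poly_eval d y \<noteq> 0 \<and> (\<forall>z\<in>Z. const_poly_eval d y * z \<in> W k)" if "finite Z" for Z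
    using that
  proof induction
    case empty
    then show ?case by (intro exI[of _ 1]) (simp add: map_poly_embed_one)
  next
    case (insert z Z)
    then obtain d k d' k' where *: "const_poly_eval d y \<noteq> 0" "\<And>z. z \<in> Z \<Longrightarrow> const_poly_eval d y * z \<in> W k"
        "const_poly_eval d' y \<noteq> 0" "const_poly_eval d' y * z \<in> W k'"
      using denom[of z] by blast
    define k'' where "k'' = k + k' + degree d + degree d'"
    have "const_poly_eval (d * d') y * w \<in> W k''" if w: "w \<in> insert z Z" for w
    proof (cases "w \<in> Z")
      case True
      have "const_poly_eval d' y * (const_poly_eval d y * w) \<in> W (k + degree d')"
        using W_poly[OF *(2)[OF True] order_refl] .
      then show ?thesis
        by (intro W_mono[of "k + degree d'" k'']) (simp_all add: k''_def map_poly_embed_mult mult_ac)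
    next
      case False
      have "const_poly_eval d y * (const_poly_eval d' y * z) \<in> W (k' + degree d)"
        using W_poly[OF *(4) order_refl] .
      then show ?thesis using False w
        by (intro W_mono[of "k' + degree d" k'']) (simp_all add: k''_def map_poly_embed_mult mult_ac)
    qed
    moreover have "const_poly_eval (d * d') y \<noteq> 0" using * by (simp add: map_poly_embed_mult)
    ultimately show ?case by blast
  qed
  have W_finite: "finite (W k) \<and> card (W k) \<le> card (UNIV :: 'q set) ^ (card B * (k + 1))" for k
  proof -
    define X where "X = (B \<times> {..k}) \<rightarrow>\<^sub>E (UNIV :: 'q set)"
    have X: "finite X" "card X = card (UNIV :: 'q set) ^ (card B * (k + 1))"
      using fB by (auto simp: X_def card_funcsetE finite_PiE card_cartesian_product)
    have "W k \<subseteq> (\<lambda>f. \<Sum>b\<in>B. (\<Sum>i\<le>k. \<iota> (f (b, i)) * y ^ i) * b) ` X"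
    proof
      fix u assume "u \<in> W k"
      then obtain a where u: "u = (\<Sum>b\<in>B. (\<Sum>i\<le>k. \<iota> (a b i) * y ^ i) * b)" by (auto simp: W_def)
      show "u \<in> (\<lambda>f. \<Sum>b\<in>B. (\<Sum>i\<le>k. \<iota> (f (b, i)) * y ^ i) * b) ` X"
        by (intro image_eqI[where x="restrict (\<lambda>(b,i). a b i) (B \<times> {..k})"])
           (auto simp: u X_def intro!: sum.cong)
    qed
    then have "finite (W k)" "card (W k) \<le> card X"
      using X(1) by (auto intro: finite_surj surj_card_le)
    then show ?thesis using X(2) by simp
  qed
  obtain d0 k0 where d0: "const_poly_eval d0 y \<noteq> 0" and k0: "\<And>b. b \<in> B \<Longrightarrow> const_poly_eval d0 y * (x * b) \<in> W k0"
    using denoms[of "(\<lambda>b. x * b) ` B"] fB by auto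
  \<comment> \<open>\<delta> is a common denominator for multiplication by \<open>x\<close> on
    \<open>B\<close>. Both \<delta> and \<delta> * x raise the filtration level by at most
    \<open>C0\<close>, whence \<delta>^k * x^j raises it by at most k * C0 for every j up to
    k.\<close>
  define C0 where "C0 = k0 + degree d0"
  define \<delta> where "\<delta> = const_poly_eval d0 y"
  have \<delta>0: "\<delta> \<noteq> 0" using d0 by (simp add: \<delta>_def)
  have W_\<delta>: "\<delta> * u \<in> W (k + C0)" if "u \<in> W k" for u k
    using W_poly[OF that, of d0 C0] by (simp add: \<delta>_def C0_def)
  have W_\<delta>x: "\<delta> * x * u \<in> W (k + C0)" if u: "u \<in> W k" for u k
  proof -
    obtain a where "u = (\<Sum>b\<in>B. (\<Sum>i\<le>k. \<iota> (a b i) * y ^ i) * b)"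
      using u by (auto simp: W_def)
    then have "\<delta> * x * u = (\<Sum>b\<in>B. \<Sum>i\<le>k. \<iota> (a b i) * (y ^ i * (\<delta> * (x * b))))"
      by (simp add: sum_distrib_left sum_distrib_right mult_ac)
    also have "\<dots> \<in> W (k + C0)"
      by (intro W_sum ballI W_scale W_mono[OF _ W_ypow[OF k0]]) (auto simp: C0_def \<delta>_def intro: W_mono[OF _ W_ypow[OF k0]])
    finally show ?thesis .
  qed
  have W_pow: "\<delta> ^ k * x ^ j * u \<in> W (C1 + k * C0)" if u: "u \<in> W C1" and "j \<le> k" for u C1 j k
    using that(2)
  proof (induction k arbitrary: j)
    case 0
    then show ?case using u by simp
  next
    case (Suc k)
    show ?case
    proof (cases j)
      case 0
      have "\<delta> * (\<delta> ^ k * x ^ 0 * u) \<in> W (C1 + k * C0 + C0)" by (intro W_\<delta> Suc.IH) simp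
      then show ?thesis using 0 by (simp add: mult_ac add_ac)
    next
      case (Suc j')
      have "\<delta> * x * (\<delta> ^ k * x ^ j' * u) \<in> W (C1 + k * C0 + C0)" using Suc \<open>j \<le> Suc k\<close> by (intro W_\<delta>x Suc.IH) simp
      then show ?thesis using Suc by (simp add: mult_ac add_ac)
    qed
  qed
  \<comment> \<open>One more than the growth rate card B * C0 of the exponent of |K| in the size of
    the target.\<close>
  define M where "M = card B * C0 + 1"
  show ?thesis
  proof (intro exI[of _ M] allI)
    fix z :: "nat \<Rightarrow> 'f"
    obtain d1 C1 where d1: "const_poly_eval d1 y \<noteq> 0" and C1: "\<And>i. i < M \<Longrightarrow> const_poly_eval d1 y * z i \<in> W C1"
      using denoms[of "z ` {..<M}"] by auto
    \<comment> \<open>Large enough to beat the constant part: card B * (C1 + k * C0 + 1) < M * (k +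
      1) then holds with a margin of card B * C0 + 1.\<close>
    define k where "k = card B * C1 + card B"
    define \<epsilon> where "\<epsilon> = const_poly_eval d1 y"
    define X where "X = ({..<M} \<times> {..k}) \<rightarrow>\<^sub>E (UNIV :: 'q set)"
    define \<Phi> where "\<Phi> f = (\<Sum>i<M. \<Sum>j\<le>k. \<iota> (f (i, j)) * (\<delta> ^ k * x ^ j * (\<epsilon> * z i)))" for f
    have "card (W (C1 + k * C0)) \<le> card (UNIV :: 'q set) ^ (card B * (C1 + k * C0 + 1))" using W_finite by blast
    also have "\<dots> < card (UNIV :: 'q set) ^ (M * (k + 1))"
    proof (intro power_strict_increasing)
      show "1 < card (UNIV :: 'q set)" using card_mono[of UNIV "{0, 1::'q}"] by simp
      show "card B * (C1 + k * C0 + 1) < M * (k + 1)"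
        by (simp add: M_def k_def algebra_simps)
    qed
    also have "\<dots> = card X" by (simp add: X_def card_funcsetE card_cartesian_product)
    finally have less: "card (W (C1 + k * C0)) < card X" .
    have "\<Phi> ` X \<subseteq> W (C1 + k * C0)"
      by (auto simp: \<Phi>_def \<epsilon>_def intro!: W_sum W_scale W_pow C1)
    then have "card (\<Phi> ` X) < card X"
      using W_finite less by (meson card_mono le_less_trans)
    then have "\<not> inj_on \<Phi> X" by (metis card_image less_irrefl)
    then obtain f f' where ff: "f \<in> X" "f' \<in> X" "f \<noteq> f'" "\<Phi> f = \<Phi> f'" by (auto simp: inj_on_def)
    define c where "c i = (\<Sum>j\<le>k. monom (f (i, j) - f' (i, j)) j)" for i
    have coeff_c: "coeff (c i) j = f (i, j) - f' (i, j)" if "j \<le> k" for i j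
      using that by (simp add: c_def coeff_sum)
    obtain i j where ij: "i < M" "j \<le> k" "f (i, j) \<noteq> f' (i, j)"
    proof -
      have "\<exists>q\<in>{..<M} \<times> {..k}. f q \<noteq> f' q"
        using ff PiE_ext[of f _ _ f'] unfolding X_def by blast
      then show ?thesis using that by auto
    qed
    have "c i \<noteq> 0" using ij coeff_c[of j i] by auto
    moreover have "(\<Sum>i<M. const_poly_eval (c i) x * z i) * (\<delta> ^ k * \<epsilon>) = \<Phi> f - \<Phi> f'"
    proof -
      have "const_poly_eval (c i) x * z i * (\<delta> ^ k * \<epsilon>) =
          (\<Sum>j\<le>k. \<iota> (f (i, j)) * (\<delta> ^ k * x ^ j * (\<epsilon> * z i))) -
          (\<Sum>j\<le>k. \<iota> (f' (i, j)) * (\<delta> ^ k * x ^ j * (\<epsilon> * z i)))" for i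
        unfolding sum_subtractf[symmetric]
        by (simp add: c_def map_poly_embed_sum map_poly_embed_monom poly_sum poly_monom
            sum_distrib_left sum_distrib_right embed_diff algebra_simps)
      then show ?thesis
        by (simp add: \<Phi>_def sum_distrib_right sum_subtractf)
    qed
    ultimately show "\<exists>c. (\<exists>i<M. c i \<noteq> 0) \<and> (\<Sum>i<M. const_poly_eval (c i) x * z i) = 0"
      using ij \<delta>0 d1 ff(4) by (intro exI[of _ c]) (auto simp: \<epsilon>_def)
  qed
qed

text \<open>Dividing a relation by the highest power of \<open>x\<close> common to all coefficients
  leaves a nonzero constant term. For \<open>x\<close> in a place this makes the relation nontrivial
  modulo the place.\<close>

lemma exists_dependence_constant_term:
  assumes x: "x \<noteq> 0"
  shows "\<exists>M. \<forall>z :: nat \<Rightarrow> 'f. \<exists>c. (\<exists>i<M. coeff (c i) 0 \<noteq> 0) \<and>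
           (\<Sum>i<M. const_poly_eval (c i) x * z i) = 0"
proof -
  obtain M where M: "\<And>z :: nat \<Rightarrow> 'f. \<exists>c. (\<exists>i<M. c i \<noteq> 0) \<and> (\<Sum>i<M. const_poly_eval (c i) x * z i) = 0"
    using exists_dependence[of x] by blast
  have "\<exists>c. (\<exists>i<M. coeff (c i) 0 \<noteq> 0) \<and> (\<Sum>i<M. const_poly_eval (c i) x * z i) = 0" for z :: "nat \<Rightarrow> 'f"
  proof -
    obtain c where c: "\<exists>i<M. c i \<noteq> 0" "(\<Sum>i<M. const_poly_eval (c i) x * z i) = 0"
      using M by blast
    define m where "m = (LEAST j. \<exists>i<M. coeff (c i) j \<noteq> 0)"
    have "\<exists>j. \<exists>i<M. coeff (c i) j \<noteq> 0" using c(1) by (meson leading_coeff_neq_0)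
    then have m: "\<exists>i<M. coeff (c i) m \<noteq> 0" unfolding m_def by (rule LeastI_ex)
    have less: "coeff (c i) j = 0" if "i < M" "j < m" for i j
      using not_less_Least[of j "\<lambda>j. \<exists>i<M. coeff (c i) j \<noteq> 0"] that unfolding m_def by blast
    have eq: "c i = monom 1 m * poly_shift m (c i)" if "i < M" for i
      using less[OF that] by (intro poly_eqI) (auto simp: coeff_monom_mult coeff_poly_shift)
    have "x ^ m * (\<Sum>i<M. const_poly_eval (poly_shift m (c i)) x * z i)
        = (\<Sum>i<M. const_poly_eval (monom 1 m * poly_shift m (c i)) x * z i)"
      by (simp add: sum_distrib_left map_poly_embed_mult map_poly_embed_monom poly_monom embed_one mult_ac)
    also have "\<dots> = (\<Sum>i<M. const_poly_eval (c i) x * z i)"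
      by (intro sum.cong) (simp_all flip: eq)
    finally show ?thesis
      using c(2) m x by (intro exI[of _ "\<lambda>i. poly_shift m (c i)"]) (auto simp: coeff_poly_shift)
  qed
  then show ?thesis by blast
qed


section \<open>Ring and ideal properties of places\<close>

text \<open>A nonzero z lies outside a valuation ring exactly when its inverse is a non-unit of it,
  so \<open>ring_of_place\<close> recovers the ring from which the place was formed.\<close>

lemma place_ring:
  assumes "place \<iota> P"
  shows "valuation_ring \<iota> (ring_of_place P)"
    and "z \<in> P \<longleftrightarrow> z \<in> ring_of_place P \<and> (z = 0 \<or> inverse z \<notin> ring_of_place P)"
proof -
  obtain R where R: "valuation_ring \<iota> R" "P = {z \<in> R. z = 0 \<or> inverse z \<notin> R}"
    using assms unfolding place_def by blast
  have "0 \<in> R" using R(1) embed_zero unfolding valuation_ring_def by (metis psubset_imp_subset rangeI subsetD)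
  then have "ring_of_place P = R"
    using R unfolding ring_of_place_def valuation_ring_def by auto
  then show "valuation_ring \<iota> (ring_of_place P)"
    "z \<in> P \<longleftrightarrow> z \<in> ring_of_place P \<and> (z = 0 \<or> inverse z \<notin> ring_of_place P)"
    using R by auto
qed

lemma
  assumes P: "place \<iota> P"
  shows place_ring_diff: "x \<in> ring_of_place P \<Longrightarrow> y \<in> ring_of_place P \<Longrightarrow> x - y \<in> ring_of_place P"
    and place_ring_mult: "x \<in> ring_of_place P \<Longrightarrow> y \<in> ring_of_place P \<Longrightarrow> x * y \<in> ring_of_place P"
    and place_ring_const: "\<iota> c \<in> ring_of_place P"
    and place_ring_inverse: "z \<notin> ring_of_place P \<Longrightarrow> inverse z \<in> ring_of_place P"
    and place_subset_ring: "z \<in> P \<Longrightarrow> z \<in> ring_of_place P"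
    and place_unit_inverse: "u \<in> ring_of_place P \<Longrightarrow> u \<notin> P \<Longrightarrow> inverse u \<in> ring_of_place P"
    and place_unit_nonzero: "u \<notin> P \<Longrightarrow> u \<noteq> 0"
proof -
  have *: "\<iota> c \<in> ring_of_place P" for c
    using place_ring(1)[OF P] unfolding valuation_ring_def by blast
  show "x \<in> ring_of_place P \<Longrightarrow> y \<in> ring_of_place P \<Longrightarrow> x - y \<in> ring_of_place P"
    "x \<in> ring_of_place P \<Longrightarrow> y \<in> ring_of_place P \<Longrightarrow> x * y \<in> ring_of_place P"
    "\<iota> c \<in> ring_of_place P"
    "z \<notin> ring_of_place P \<Longrightarrow> inverse z \<in> ring_of_place P"
    using place_ring(1)[OF P] * unfolding valuation_ring_def by blast+
  show "z \<in> P \<Longrightarrow> z \<in> ring_of_place P"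
    "u \<in> ring_of_place P \<Longrightarrow> u \<notin> P \<Longrightarrow> inverse u \<in> ring_of_place P"
    "u \<notin> P \<Longrightarrow> u \<noteq> 0"
    using place_ring(2)[OF P] *[of 0] by auto
qed

lemma
  assumes P: "place \<iota> P"
  shows place_ring_zero: "0 \<in> ring_of_place P"
    and place_ring_one: "1 \<in> ring_of_place P"
    and place_zero: "0 \<in> P"
    and place_one: "1 \<notin> P"
  using place_ring_const[OF P, of 0] place_ring_const[OF P, of 1] place_ring(2)[OF P]
  by (simp_all add: embed_one)

lemma place_ring_uminus: "place \<iota> P \<Longrightarrow> x \<in> ring_of_place P \<Longrightarrow> - x \<in> ring_of_place P"
  using place_ring_diff[of P 0 x] by (simp add: place_ring_zero)

lemma place_ring_add:
  "place \<iota> P \<Longrightarrow> x \<in> ring_of_place P \<Longrightarrow> y \<in> ring_of_place P \<Longrightarrow> x + y \<in> ring_of_place P"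
  using place_ring_diff[of P x "- y"] by (simp add: place_ring_uminus)

lemma place_ring_sum:
  "place \<iota> P \<Longrightarrow> (\<And>i. i \<in> I \<Longrightarrow> f i \<in> ring_of_place P) \<Longrightarrow> sum f I \<in> ring_of_place P"
  by (induction I rule: infinite_finite_induct) (auto simp: place_ring_zero place_ring_add)

lemma place_ring_power: "place \<iota> P \<Longrightarrow> x \<in> ring_of_place P \<Longrightarrow> x ^ k \<in> ring_of_place P"
  by (induction k) (auto simp: place_ring_one place_ring_mult)

lemma place_mult:
  assumes P: "place \<iota> P" and x: "x \<in> P" and y: "y \<in> ring_of_place P"
  shows "x * y \<in> P"
proof (cases "x = 0 \<or> y = 0")
  case True
  then show ?thesis by (auto simp: place_zero[OF P])
next
  case False
  have "inverse (x * y) \<notin> ring_of_place P"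
  proof
    assume "inverse (x * y) \<in> ring_of_place P"
    then have "inverse (x * y) * y \<in> ring_of_place P" using y by (rule place_ring_mult[OF P])
    then show False using x False place_ring(2)[OF P, of x] by (auto simp: field_simps)
  qed
  then show ?thesis using place_ring(2)[OF P] place_ring_mult[OF P] x y by blast
qed

lemma place_uminus:
  assumes P: "place \<iota> P" and x: "x \<in> P"
  shows "- x \<in> P"
  using place_mult[OF P x place_ring_uminus[OF P place_ring_one[OF P]]] by simp

text \<open>Of two nonzero elements one divides the other in the valuation ring, so the sum is a
  ring multiple of \<open>x\<close> or of \<open>y\<close>.\<close>

lemma place_add:
  assumes P: "place \<iota> P" and x: "x \<in> P" and y: "y \<in> P"
  shows "x + y \<in> P"
proof -
  have *: "x + y \<in> P" if "x \<in> P" "y \<noteq> 0" "y \<in> P" "x / y \<in> ring_of_place P" for x y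
  proof -
    have "y * (x / y + 1) \<in> P"
      using that by (intro place_mult[OF P] place_ring_add[OF P] place_ring_one[OF P])
    also have "y * (x / y + 1) = x + y"
      using that by (simp add: distrib_left)
    finally show ?thesis .
  qed
  show ?thesis
  proof (cases "x = 0 \<or> y = 0")
    case False
    then show ?thesis
      using *[of x y] *[of y x] x y place_ring_inverse[OF P, of "x / y"] by (auto simp: add.commute)
  qed (use x y in auto)
qed

lemma place_diff:
  "place \<iota> P \<Longrightarrow> x \<in> P \<Longrightarrow> y \<in> P \<Longrightarrow> x - y \<in> P"
  using place_add[of P x "- y"] by (simp add: place_uminus)

lemma place_sum: "place \<iota> P \<Longrightarrow> (\<And>i. i \<in> I \<Longrightarrow> f i \<in> P) \<Longrightarrow> sum f I \<in> P"
  by (induction I rule: infinite_finite_induct) (auto simp: place_zero place_add)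

lemma place_const_iff:
  assumes P: "place \<iota> P"
  shows "\<iota> c \<in> P \<longleftrightarrow> c = 0"
  using place_ring(2)[OF P, of "\<iota> c"] place_ring_const[OF P, of c]
    place_ring_const[OF P, of "inverse c"] by (auto simp: embed_inverse)

lemma place_unit_mult:
  assumes P: "place \<iota> P" and "x \<in> ring_of_place P - P" "y \<in> ring_of_place P - P"
  shows "x * y \<in> ring_of_place P - P"
proof -
  have "x * y \<notin> P"
  proof
    assume "x * y \<in> P"
    then have "x * y * inverse y \<in> P"
      using assms place_mult[OF P _ place_unit_inverse[OF P]] by blast
    moreover have "y \<noteq> 0" using assms(3) place_unit_nonzero[OF P, of y] by blast
    then have "x * y * inverse y = x" by simp
    ultimately show False using assms by simp
  qed
  then show ?thesis using assms place_ring_mult[OF P] by auto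
qed

lemma place_unit_inverse':
  assumes P: "place \<iota> P" and u: "u \<in> ring_of_place P - P"
  shows "inverse u \<in> ring_of_place P - P"
  using assms place_unit_inverse[OF P, of u] place_ring(2)[OF P, of "inverse u"] place_zero[OF P]
  by auto

lemma place_unit_powi:
  assumes P: "place \<iota> P" and u: "u \<in> ring_of_place P - P"
  shows "u powi k \<in> ring_of_place P - P"
proof -
  have "u ^ n \<in> ring_of_place P - P" if "u \<in> ring_of_place P - P" for u n
    using that place_unit_mult[OF P] by (induction n) (auto simp: place_one[OF P] place_ring_one[OF P])
  then show ?thesis
    using u place_unit_inverse'[OF P u] by (auto simp: power_int_def)
qed

lemma place_nontrivial:
  assumes P: "place \<iota> P"
  obtains x where "x \<in> P" "x \<noteq> 0"
proof -
  obtain z where z: "z \<notin> ring_of_place P"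
    using place_ring(1)[OF P] unfolding valuation_ring_def by auto
  then have "z \<noteq> 0" using place_ring_zero[OF P] by auto
  then have "inverse z \<in> P" using z place_ring(2)[OF P] place_ring_inverse[OF P z] by auto
  then show ?thesis using that \<open>z \<noteq> 0\<close> by auto
qed

lemma const_poly_eval_in_place_ring:
  assumes P: "place \<iota> P" and x: "x \<in> ring_of_place P"
  shows "const_poly_eval a x \<in> ring_of_place P"
  unfolding const_poly_eval_altdef
  by (intro place_ring_sum[OF P] place_ring_mult[OF P] place_ring_const[OF P] place_ring_power[OF P] x)

text \<open>Reduction modulo a place containing \<open>x\<close>: only the constant term
  survives.\<close>

lemma const_poly_eval_split:
  obtains b where "const_poly_eval a x = \<iota> (coeff a 0) + x * const_poly_eval b x"
  by (cases a) (auto simp: map_poly_pCons)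

subsection \<open>Discreteness of places\<close>

text \<open>Elements of strictly decreasing valuation, the first of which is \<open>x\<close>, are linearly
  independent over \<open>K[x]\<close>.\<close>

lemma place_chain_bounded:
  assumes P: "place \<iota> P" and x: "x \<in> P" "x \<noteq> 0"
  shows "\<exists>M::nat. \<not> (\<exists>z. z 0 = x \<and> (\<forall>i<M. z i \<in> P \<and> z i \<noteq> 0) \<and> (\<forall>i j. i < j \<longrightarrow> j < M \<longrightarrow> z i / z j \<in> P))"
proof -
  obtain M where M: "\<And>z :: nat \<Rightarrow> 'f. \<exists>c. (\<exists>i<M. coeff (c i) 0 \<noteq> 0) \<and>
           (\<Sum>i<M. const_poly_eval (c i) x * z i) = 0"
    using exists_dependence_constant_term[OF x(2)] by blast
  show ?thesis
  proof (rule exI[of _ M], rule notI, elim exE conjE)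
    fix z assume z0: "z 0 = x" and z: "\<forall>i<M. z i \<in> P \<and> z i \<noteq> 0" and
      chain: "\<forall>i j. i < j \<longrightarrow> j < M \<longrightarrow> z i / z j \<in> P"
    obtain c where c: "\<exists>i<M. coeff (c i) 0 \<noteq> 0" and sum: "(\<Sum>i<M. const_poly_eval (c i) x * z i) = 0"
      using M by blast
    \<comment> \<open>Divide the relation by \<open>z j\<close>, where \<open>j\<close> is the last
      index with nonzero constant term. Earlier quotients lie in P by the chain condition. Later
      coefficients are divisible by \<open>x\<close>, and \<open>x / z j\<close> is integral because
      the chain starts at \<open>x\<close>. Only the constant term of \<open>c j\<close> remains
      modulo P, so it would have to vanish.\<close>
    define j where "j = Max {i. i < M \<and> coeff (c i) 0 \<noteq> 0}"
    have "j \<in> {i. i < M \<and> coeff (c i) 0 \<noteq> 0}" unfolding j_def using c by (intro Max_in) auto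
    then have j: "j < M" "coeff (c j) 0 \<noteq> 0" by auto
    have jmax: "coeff (c i) 0 = 0" if "j < i" "i < M" for i
    proof (rule ccontr)
      assume "coeff (c i) 0 \<noteq> 0"
      then have "i \<le> j" unfolding j_def using that by (intro Max_ge) auto
      then show False using that by simp
    qed
    have xj: "x / z j \<in> ring_of_place P"
    proof (cases "j = 0")
      case True
      then show ?thesis using z0 x place_ring_one[OF P] by simp
    next
      case False
      then have "z 0 / z j \<in> P" using chain j by blast
      then show ?thesis using z0 place_subset_ring[OF P] by simp
    qed
    have "const_poly_eval (c i) x * (z i / z j) \<in> P" if i: "i < M" "i \<noteq> j" for i
    proof (cases "i < j")
      case True
      then have "(z i / z j) * const_poly_eval (c i) x \<in> P"
        using chain j x by (intro place_mult[OF P] const_poly_eval_in_place_ring[OF P] place_subset_ring[OF P]) auto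
      then show ?thesis by (simp only: mult.commute)
    next
      case False
      obtain b where b: "const_poly_eval (c i) x = \<iota> (coeff (c i) 0) + x * const_poly_eval b x"
        by (rule const_poly_eval_split)
      have "z i * ((x / z j) * const_poly_eval b x) \<in> P"
        using z i x xj by (intro place_mult[OF P _ place_ring_mult[OF P]] const_poly_eval_in_place_ring[OF P] place_subset_ring[OF P x(1)]) auto
      then show ?thesis using b jmax[of i] i False by (simp add: field_simps)
    qed
    then have *: "(\<Sum>i\<in>{..<M} - {j}. const_poly_eval (c i) x * (z i / z j)) \<in> P"
      by (intro place_sum[OF P]) auto
    have "(\<Sum>i<M. const_poly_eval (c i) x * (z i / z j)) = 0"
      using sum by (simp add: sum_divide_distrib[symmetric])
    then have "const_poly_eval (c j) x = - (\<Sum>i\<in>{..<M} - {j}. const_poly_eval (c i) x * (z i / z j))"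
      using j z by (simp add: sum.remove[of "{..<M}" j] add_eq_0_iff)
    then have "const_poly_eval (c j) x \<in> P" using place_uminus[OF P *] by simp
    moreover obtain b where b: "const_poly_eval (c j) x = \<iota> (coeff (c j) 0) + x * const_poly_eval b x"
      by (rule const_poly_eval_split)
    moreover have "x * const_poly_eval b x \<in> P"
      using x by (intro place_mult[OF P] const_poly_eval_in_place_ring[OF P] place_subset_ring[OF P])
    ultimately have "\<iota> (coeff (c j) 0) \<in> P" using place_diff[OF P] by (metis add_diff_cancel_right')
    then show False using j place_const_iff[OF P] by simp
  qed
qed

text \<open>If no element generated P, each nonzero z in P would miss some y in P, and then z / y
  lies in P. Iterating gives chains of every length, against
  \<open>place_chain_bounded\<close>.\<close>

lemma local_parameter_exists:
  assumes P: "place \<iota> P"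
  obtains t where "local_parameter P t"
proof (rule ccontr)
  assume "\<not> thesis"
  then have no: "\<not> local_parameter P t" for t using that by blast
  have step: "\<exists>y. y \<in> P \<and> y \<noteq> 0 \<and> z / y \<in> P" if z: "z \<in> P" "z \<noteq> 0" for z
  proof -
    have "{z * w | w. w \<in> ring_of_place P} \<subseteq> P" using place_mult[OF P z(1)] by blast
    then obtain y where y: "y \<in> P" "\<And>w. w \<in> ring_of_place P \<Longrightarrow> y \<noteq> z * w"
      using no[of z] unfolding local_parameter_def by blast
    have y0: "y \<noteq> 0" using y(2)[OF place_ring_zero[OF P]] by simp
    have "y / z \<notin> ring_of_place P" using y(2)[of "y / z"] z by auto
    then have "z / y \<in> P"
      using place_ring_inverse[OF P, of "y / z"] place_ring(2)[OF P, of "z / y"] by (simp add: field_simps)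
    then show ?thesis using y y0 by blast
  qed
  then obtain f where f: "\<And>z. z \<in> P \<Longrightarrow> z \<noteq> 0 \<Longrightarrow> f z \<in> P \<and> f z \<noteq> 0 \<and> z / f z \<in> P" by metis
  obtain x where x: "x \<in> P" "x \<noteq> 0" using place_nontrivial[OF P] .
  define z where "z i = (f ^^ i) x" for i
  have z: "z i \<in> P \<and> z i \<noteq> 0" for i by (induction i) (use x f in \<open>auto simp: z_def\<close>)
  have "z i / z j \<in> P" if "i < j" for i j
    using that
  proof (induction j)
    case (Suc j)
    have 1: "z j / z (Suc j) \<in> P" using f z[of j] by (simp add: z_def)
    show ?case
    proof (cases "i = j")
      case False
      then have "z i / z j \<in> P" using Suc by simp
      then have "(z i / z j) * (z j / z (Suc j)) \<in> P"
        using 1 by (intro place_mult[OF P] place_subset_ring[OF P])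
      then show ?thesis using z[of j] by simp
    qed (use 1 in simp)
  qed simp
  moreover have "z 0 = x" by (simp add: z_def)
  ultimately show False using place_chain_bounded[OF P x] z by blast
qed

lemma local_parameter_iff:
  assumes "local_parameter P t"
  shows "z \<in> P \<longleftrightarrow> (\<exists>w\<in>ring_of_place P. z = t * w)"
proof -
  have "z \<in> P \<longleftrightarrow> z \<in> {t * w | w. w \<in> ring_of_place P}"
    using assms unfolding local_parameter_def by (rule arg_cong)
  then show ?thesis by blast
qed

lemma local_parameter_in_place:
  assumes "place \<iota> P" and "local_parameter P t"
  shows "t \<in> P"
  unfolding local_parameter_iff[OF assms(2)]
  by (intro bexI[of _ 1]) (simp_all add: place_ring_one[OF assms(1)])

lemma local_parameter_nonzero:
  assumes "place \<iota> P" and "local_parameter P t"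
  shows "t \<noteq> 0"
proof
  assume "t = 0"
  obtain x where "x \<in> P" "x \<noteq> 0" using place_nontrivial[OF assms(1)] .
  then show False using \<open>t = 0\<close> unfolding local_parameter_iff[OF assms(2)] by simp
qed

lemma power_local_parameter_in_place:
  assumes P: "place \<iota> P" and t: "local_parameter P t" and n: "0 < n"
  shows "t ^ n \<in> P"
  using place_mult[OF P local_parameter_in_place[OF P t]
      place_ring_power[OF P place_subset_ring[OF P local_parameter_in_place[OF P t]]], of "n - 1"] n
  by (simp add: power_eq_if)

text \<open>The point is that z cannot be divisible by all powers of t; this again rests on
  \<open>place_chain_bounded\<close>. Elements outside the ring are handled through their
  inverses.\<close>

lemma local_parameter_factorization:
  assumes P: "place \<iota> P" and t: "local_parameter P t" and z: "z \<noteq> 0"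
  obtains k u where "u \<in> ring_of_place P - P" "z = t powi k * u"
proof -
  have t0: "t \<noteq> 0" using local_parameter_nonzero[OF P t] .
  have int: "\<exists>k::nat. \<exists>u \<in> ring_of_place P - P. z = t ^ k * u"
    if z: "z \<in> ring_of_place P" "z \<noteq> 0" for z
  proof (rule ccontr)
    assume no: "\<not> ?thesis"
    have ex: "\<exists>w\<in>ring_of_place P. z = t ^ n * w" for n
    proof (induction n)
      case 0
      then show ?case using z by auto
    next
      case (Suc n)
      then obtain w where w: "w \<in> ring_of_place P" "z = t ^ n * w" by blast
      then have "w \<in> P" using no by blast
      then obtain w' where "w' \<in> ring_of_place P" "w = t * w'"
        using local_parameter_iff[OF t] by blast
      then show ?case using w by (intro bexI[of _ w']) (auto simp: mult_ac)
    qed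
    have z_in: "z / t ^ n \<in> P" for n
    proof -
      obtain w where "w\<in>ring_of_place P" "z = t ^ Suc n * w" using ex by blast
      then have "z / t ^ n = t * w" using t0 by simp
      then show ?thesis using \<open>w\<in>ring_of_place P\<close> place_mult[OF P local_parameter_in_place[OF P t]] by simp
    qed
    obtain M :: nat where M: "\<not> (\<exists>y. y 0 = z \<and> (\<forall>i<M. y i \<in> P \<and> y i \<noteq> 0) \<and> (\<forall>i j. i < j \<longrightarrow> j < M \<longrightarrow> y i / y j \<in> P))"
      using place_chain_bounded[OF P, of z] z_in[of 0] z(2) unfolding power_0 div_by_1 by blast
    \<comment> \<open>The chain z, t^(M-1), ..., t^1. The exponents run downwards because valuations
      must decrease, and z may come first since every power of t divides it.\<close>
    define y where "y i = (if i = 0 then z else t ^ (M - i))" for i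
    have "y i \<in> P \<and> y i \<noteq> 0" if "i < M" for i
      using that z_in[of 0] z t0 power_local_parameter_in_place[OF P t, of "M - i"] by (auto simp: y_def)
    moreover have "y i / y j \<in> P" if ij: "i < j" "j < M" for i j
    proof (cases "i = 0")
      case True
      then show ?thesis using z_in ij by (auto simp: y_def)
    next
      case False
      have "t ^ (M - i) / t ^ (M - j) = t ^ (j - i)"
        using ij t0 by (simp flip: power_diff)
      then show ?thesis using False ij power_local_parameter_in_place[OF P t, of "j - i"]
        by (simp add: y_def)
    qed
    moreover have "y 0 = z" by (simp add: y_def)
    ultimately show False using M by blast
  qed
  show ?thesis
  proof (cases "z \<in> ring_of_place P")
    case True
    then obtain k u where "u \<in> ring_of_place P - P" "z = t ^ k * u" using int z by blast
    then show ?thesis using that[of u "int k"] by simp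
  next
    case False
    then obtain k u where ku: "u \<in> ring_of_place P - P" "inverse z = t ^ k * u"
      using int[OF place_ring_inverse[OF P False]] z by auto
    have "z = inverse (inverse z)" by simp
    also have "\<dots> = t powi (- int k) * inverse u" unfolding ku(2) by (simp add: power_int_minus)
    finally show ?thesis using that place_unit_inverse'[OF P ku(1)] by blast
  qed
qed

lemma powi_local_parameter_in_ring_iff:
  assumes P: "place \<iota> P" and t: "local_parameter P t" and u: "u \<in> ring_of_place P - P"
  shows "t powi k * u \<in> ring_of_place P \<longleftrightarrow> 0 \<le> k"
proof (cases "0 \<le> k")
  case True
  have "t ^ nat k * u \<in> ring_of_place P"
    using u place_ring_mult[OF P place_ring_power[OF P place_subset_ring[OF P local_parameter_in_place[OF P t]]]]
    by blast
  then show ?thesis using True by (simp add: power_int_def)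
next
  case False
  have t0: "t \<noteq> 0" "u \<noteq> 0" using local_parameter_nonzero[OF P t] u place_unit_nonzero[OF P, of u] by blast+
  have "t powi k * u \<notin> ring_of_place P"
  proof
    assume *: "t powi k * u \<in> ring_of_place P"
    have "t ^ nat (- k) * (t powi k * u * inverse u) \<in> P"
      using False u by (intro place_mult[OF P] place_ring_mult[OF P *]
          power_local_parameter_in_place[OF P t] place_unit_inverse[OF P]) auto
    also have "t ^ nat (- k) * (t powi k * u * inverse u) = 1"
      using t0 False by (simp add: power_int_def field_simps)
    finally show False using place_one[OF P] by simp
  qed
  then show ?thesis using False by simp
qed

section \<open>The normalised valuation\<close>

text \<open>Evaluates the \<open>THE\<close> in \<open>valuation\<close> once and for all. Valuation
  bounds become ring membership with respect to one fixed local parameter, zero included, and the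
  later valuation rules follow from closure of the ring.\<close>

lemma valuation_ge_iff:
  assumes P: "place \<iota> P" and t: "local_parameter P t"
  shows "valuation_ge P z k \<longleftrightarrow> z * t powi (- k) \<in> ring_of_place P"
proof (cases "z = 0")
  case True
  then show ?thesis by (simp add: valuation_ge_def place_ring_zero[OF P])
next
  case False
  have t0: "t \<noteq> 0" using local_parameter_nonzero[OF P t] .
  obtain m u where mu: "u \<in> ring_of_place P - P" "z = t powi m * u"
    using local_parameter_factorization[OF P t False] by blast
  have "valuation P z = m"
    unfolding valuation_def
  proof (rule the_equality)
    show "\<exists>t u. local_parameter P t \<and> u \<in> ring_of_place P - P \<and> z = t powi m * u"
      using t mu by blast
  next
    \<comment> \<open>Two local parameters differ by a unit \<open>w\<close>. Hence t^(m-k) and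
      t^(k-m), each times a unit, both lie in the ring, which forces k = m.\<close>
    fix k assume "\<exists>t u. local_parameter P t \<and> u \<in> ring_of_place P - P \<and> z = t powi k * u"
    then obtain s v where s: "local_parameter P s" "v \<in> ring_of_place P - P" "z = s powi k * v"
      by blast
    have s0: "s \<noteq> 0" using local_parameter_nonzero[OF P s(1)] .
    obtain w where w: "w \<in> ring_of_place P" "s = t * w"
      using local_parameter_in_place[OF P s(1)] local_parameter_iff[OF t] by blast
    obtain w' where w': "w' \<in> ring_of_place P" "t = s * w'"
      using local_parameter_in_place[OF P t] local_parameter_iff[OF s(1)] by blast
    have "w * w' = 1" using w(2) w'(2) t0 by (auto simp: mult.commute)
    then have wu: "w \<in> ring_of_place P - P"
      using place_mult[OF P _ w'(1), of w] place_one[OF P] w by auto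
    have v0: "v \<noteq> 0" "u \<noteq> 0"
      using s(2) mu(1) place_unit_nonzero[OF P] by blast+
    have w0: "w \<noteq> 0" using wu place_unit_nonzero[OF P] by blast
    have "t powi m * u = t powi k * (w powi k * v)"
      using s(3) mu(2) w(2) by (simp add: power_int_mult_distrib mult_ac)
    then have 1: "t powi (m - k) * (u * inverse v) = w powi k"
       "t powi (k - m) * (w powi k * (v * inverse u)) = 1"
      using t0 v0 w0 by (simp_all add: power_int_diff field_simps)
    have "t powi (m - k) * (u * inverse v) \<in> ring_of_place P"
      "t powi (k - m) * (w powi k * (v * inverse u)) \<in> ring_of_place P"
      unfolding 1 using place_unit_powi[OF P wu] place_ring_one[OF P] by auto
    moreover have "u * inverse v \<in> ring_of_place P - P"  "w powi k * (v * inverse u) \<in> ring_of_place P - P"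
      using place_unit_mult[OF P] place_unit_inverse'[OF P] place_unit_powi[OF P wu] mu s(2) by blast+
    ultimately show "k = m"
      using powi_local_parameter_in_ring_iff[OF P t, of "u * inverse v" "m - k"]
        powi_local_parameter_in_ring_iff[OF P t, of "w powi k * (v * inverse u)" "k - m"] by simp
  qed
  moreover have "z * t powi (- k) = t powi (m - k) * u"
    using mu t0 by (simp add: power_int_diff power_int_minus field_simps)
  ultimately show ?thesis
    using False powi_local_parameter_in_ring_iff[OF P t mu(1), of "m - k"] by (simp add: valuation_ge_def)
qed

lemma valuation_ge_zero [simp]: "valuation_ge P 0 k"
  by (simp add: valuation_ge_def)

lemma valuation_ge_mono: "valuation_ge P z k \<Longrightarrow> k' \<le> k \<Longrightarrow> valuation_ge P z k'"
  by (auto simp: valuation_ge_def)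

lemma valuation_ge_0_iff:
  assumes P: "place \<iota> P"
  shows "valuation_ge P z 0 \<longleftrightarrow> z \<in> ring_of_place P"
proof -
  obtain t where t: "local_parameter P t" using local_parameter_exists[OF P] .
  show ?thesis unfolding valuation_ge_iff[OF P t] by simp
qed

lemma valuation_ge_1_iff:
  assumes P: "place \<iota> P"
  shows "valuation_ge P z 1 \<longleftrightarrow> z \<in> P"
proof -
  obtain t where t: "local_parameter P t" using local_parameter_exists[OF P] .
  have t0: "t \<noteq> 0" using local_parameter_nonzero[OF P t] .
  have "z \<in> P \<longleftrightarrow> z / t \<in> ring_of_place P"
    unfolding local_parameter_iff[OF t] using t0 by (auto intro!: bexI[of _ "z / t"])
  then show ?thesis using valuation_ge_iff[OF P t] by (simp add: power_int_minus field_simps)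
qed

lemma valuation_ge_add:
  assumes "place \<iota> P" "valuation_ge P x k" "valuation_ge P y k"
  shows "valuation_ge P (x + y) k"
proof -
  obtain t where t: "local_parameter P t" using local_parameter_exists[OF assms(1)] .
  show ?thesis
    using assms(2,3) place_ring_add[OF assms(1)]
    unfolding valuation_ge_iff[OF assms(1) t] by (simp add: distrib_right)
qed

lemma valuation_ge_mult:
  assumes P: "place \<iota> P" and "valuation_ge P x k" "valuation_ge P y k'"
  shows "valuation_ge P (x * y) (k + k')"
proof -
  obtain t where t: "local_parameter P t" using local_parameter_exists[OF P] .
  have "(x * t powi (- k)) * (y * t powi (- k')) \<in> ring_of_place P"
    using assms valuation_ge_iff[OF P t] place_ring_mult[OF P] by blast
  also have "(x * t powi (- k)) * (y * t powi (- k')) = x * y * t powi (- (k + k'))"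
    using local_parameter_nonzero[OF P t] by (simp add: power_int_diff power_int_minus field_simps)
  finally show ?thesis using valuation_ge_iff[OF P t] by blast
qed

lemma valuation_ge_const: "place \<iota> P \<Longrightarrow> valuation_ge P (\<iota> c) 0"
  by (simp add: valuation_ge_0_iff place_ring_const)

lemma valuation_ge_one: "place \<iota> P \<Longrightarrow> valuation_ge P 1 0"
  by (simp add: valuation_ge_0_iff place_ring_one)

lemma valuation_ge_const_mult:
  "place \<iota> P \<Longrightarrow> valuation_ge P x k \<Longrightarrow> valuation_ge P (\<iota> c * x) k"
  using valuation_ge_mult[of P "\<iota> c" 0 x k] by (simp add: valuation_ge_const)

lemma valuation_ge_uminus: "place \<iota> P \<Longrightarrow> valuation_ge P x k \<Longrightarrow> valuation_ge P (- x) k"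
  using valuation_ge_const_mult[of P x k "- 1"] by (simp add: embed_uminus embed_one)

lemma valuation_ge_diff:
  "place \<iota> P \<Longrightarrow> valuation_ge P x k \<Longrightarrow> valuation_ge P y k \<Longrightarrow> valuation_ge P (x - y) k"
  using valuation_ge_add[of P x k "- y"] by (simp add: valuation_ge_uminus)

lemma valuation_ge_sum:
  "place \<iota> P \<Longrightarrow> (\<And>i. i \<in> I \<Longrightarrow> valuation_ge P (f i) k) \<Longrightarrow> valuation_ge P (sum f I) k"
  by (induction I rule: infinite_finite_induct) (auto intro: valuation_ge_add)

lemma valuation_ge_power:
  assumes P: "place \<iota> P" and x: "valuation_ge P x k"
  shows "valuation_ge P (x ^ n) (int n * k)"
proof (induction n)
  case (Suc n)
  then show ?case using valuation_ge_mult[OF P x Suc] by (simp add: algebra_simps)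
qed (simp add: valuation_ge_one[OF P])


subsection \<open>Residue fields\<close>

text \<open>For x in P, a relation over K[x] reduces modulo P to the K-relation formed by the
  constant terms, at least one of which is nonzero. So the \<open>M\<close> of the dependence lemma
  bounds the dimension of the residue field.\<close>

lemma residue_independent_bounded:
  assumes P: "place \<iota> P"
  shows "\<exists>M. \<forall>B. finite B \<and> B \<subseteq> ring_of_place P \<and>
           (\<forall>c. (\<Sum>b\<in>B. \<iota> (c b) * b) \<in> P \<longrightarrow> (\<forall>b\<in>B. c b = 0)) \<longrightarrow> card B < M"
proof -
  obtain x where x: "x \<in> P" "x \<noteq> 0" using place_nontrivial[OF P] .
  obtain M where M: "\<And>z :: nat \<Rightarrow> 'f. \<exists>c. (\<exists>i<M. coeff (c i) 0 \<noteq> 0) \<and>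
           (\<Sum>i<M. const_poly_eval (c i) x * z i) = 0"
    using exists_dependence_constant_term[OF x(2)] by blast
  have "card B < M" if B: "finite B" "B \<subseteq> ring_of_place P"
    and ind: "\<And>c. (\<Sum>b\<in>B. \<iota> (c b) * b) \<in> P \<Longrightarrow> \<forall>b\<in>B. c b = 0" for B
  proof (rule ccontr)
    assume "\<not> card B < M"
    obtain e where e: "bij_betw e {0..<card B} B" using ex_bij_betw_nat_finite[OF B(1)] by blast
    define C where "C = e ` {..<M}"
    have inj: "inj_on e {..<M}"
      using e \<open>\<not> card B < M\<close> unfolding bij_betw_def by (auto intro: inj_on_subset)
    have CB: "C \<subseteq> B" using e \<open>\<not> card B < M\<close> unfolding C_def bij_betw_def by auto
    obtain c where c: "\<exists>i<M. coeff (c i) 0 \<noteq> 0" "(\<Sum>i<M. const_poly_eval (c i) x * e i) = 0"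
      using M[of e] by blast
    have "const_poly_eval (c i) x * e i - \<iota> (coeff (c i) 0) * e i \<in> P" if "i < M" for i
    proof -
      obtain b where b: "const_poly_eval (c i) x = \<iota> (coeff (c i) 0) + x * const_poly_eval b x"
        by (rule const_poly_eval_split)
      have "e i \<in> ring_of_place P" using CB B(2) that by (auto simp: C_def)
      then have "x * (const_poly_eval b x * e i) \<in> P"
        by (intro place_mult[OF P x(1)] place_ring_mult[OF P] const_poly_eval_in_place_ring[OF P place_subset_ring[OF P x(1)]])
      then show ?thesis by (simp add: b algebra_simps)
    qed
    then have "(\<Sum>i<M. const_poly_eval (c i) x * e i - \<iota> (coeff (c i) 0) * e i) \<in> P"
      by (intro place_sum[OF P]) auto
    then have "- (\<Sum>i<M. \<iota> (coeff (c i) 0) * e i) \<in> P"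
      unfolding sum_subtractf c(2) by simp
    then have *: "(\<Sum>i<M. \<iota> (coeff (c i) 0) * e i) \<in> P" using place_uminus[OF P] by fastforce
    define c' where "c' b = (if b \<in> C then coeff (c (the_inv_into {..<M} e b)) 0 else 0)" for b
    have c'e: "c' (e i) = coeff (c i) 0" if "i < M" for i
      using that inj by (simp add: c'_def C_def the_inv_into_f_f)
    have "(\<Sum>b\<in>B. \<iota> (c' b) * b) = (\<Sum>b\<in>C. \<iota> (c' b) * b)"
      using CB B(1) by (intro sum.mono_neutral_right) (auto simp: c'_def)
    also have "\<dots> = (\<Sum>i<M. \<iota> (coeff (c i) 0) * e i)"
      unfolding C_def by (subst sum.reindex[OF inj]) (simp add: c'e)
    finally have "\<forall>b\<in>B. c' b = 0" using * ind by metis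
    then have "coeff (c i) 0 = 0" if "i < M" for i
      using c'e[OF that] CB that by (auto simp: C_def)
    then show False using c(1) by blast
  qed
  then show ?thesis by blast
qed

text \<open>The bound on independent sets provides one of maximal size, and maximality makes it
  span. \<open>place_degree\<close> is a \<open>THE\<close>, so degree 1 carries information only
  once a basis exists and all bases have the same size.\<close>

lemma residue_basis_exists:
  assumes P: "place \<iota> P"
  obtains B where "residue_basis \<iota> P B"
proof -
  define indep where "indep B \<longleftrightarrow> finite B \<and> B \<subseteq> ring_of_place P \<and>
    (\<forall>c. (\<Sum>b\<in>B. \<iota> (c b) * b) \<in> P \<longrightarrow> (\<forall>b\<in>B. c b = 0))" for B
  obtain M where M: "\<forall>B. indep B \<longrightarrow> card B < M"
    using residue_independent_bounded[OF P] unfolding indep_def by blast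
  have "\<exists>B. indep B \<and> (\<forall>B'. indep B' \<longrightarrow> card B' \<le> card B)"
    by (rule ex_has_greatest_nat[of indep "{}" card M, OF _ M]) (simp add: indep_def)
  then obtain B where B: "indep B" "\<And>B'. indep B' \<Longrightarrow> card B' \<le> card B"
    by blast
  have span: "\<exists>c. z - (\<Sum>b\<in>B. \<iota> (c b) * b) \<in> P" if z: "z \<in> ring_of_place P" for z
  proof (cases "z \<in> B")
    case True
    have "(\<Sum>b\<in>B. \<iota> (if b = z then 1 else 0) * b) = (\<Sum>b\<in>B. if b = z then b else 0)"
      by (intro sum.cong) (auto simp: embed_one)
    also have "\<dots> = z" using True B(1) by (simp add: indep_def)
    finally show ?thesis using place_zero[OF P] by (intro exI[of _ "\<lambda>b. if b = z then 1 else 0"]) simp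
  next
    case False
    have "finite B" using B(1) by (simp add: indep_def)
    then have "\<not> indep (insert z B)" using B(2)[of "insert z B"] False by auto
    then obtain c where c: "(\<Sum>b\<in>insert z B. \<iota> (c b) * b) \<in> P" "\<exists>b\<in>insert z B. c b \<noteq> 0"
      using B(1) z unfolding indep_def by blast
    have sum: "\<iota> (c z) * z + (\<Sum>b\<in>B. \<iota> (c b) * b) \<in> P"
      using c(1) False B(1) by (simp add: indep_def)
    have cz: "c z \<noteq> 0"
    proof
      assume "c z = 0"
      then have "\<forall>b\<in>B. c b = 0" using sum B(1) unfolding indep_def by simp
      then show False using c(2) \<open>c z = 0\<close> by blast
    qed
    have "(\<iota> (c z) * z + (\<Sum>b\<in>B. \<iota> (c b) * b)) * \<iota> (inverse (c z)) \<in> P"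
      using sum by (intro place_mult[OF P] place_ring_const[OF P])
    also have "(\<iota> (c z) * z + (\<Sum>b\<in>B. \<iota> (c b) * b)) * \<iota> (inverse (c z)) =
        z - (\<Sum>b\<in>B. \<iota> (- c b * inverse (c z)) * b)"
      using cz by (simp add: distrib_left embed_mult embed_uminus embed_inverse sum_distrib_left sum_negf mult_ac)
    finally show ?thesis by (intro exI[of _ "\<lambda>b. - c b * inverse (c z)"])
  qed
  have "residue_basis \<iota> P B"
    unfolding residue_basis_def
  proof (intro conjI ballI)
    show "finite B" "B \<subseteq> ring_of_place P" using B(1) by (auto simp: indep_def)
    fix z assume "z \<in> ring_of_place P"
    then obtain c where c: "z - (\<Sum>b\<in>B. \<iota> (c b) * b) \<in> P" using span by blast
    show "\<exists>!c. (\<forall>b. b \<notin> B \<longrightarrow> c b = 0) \<and> z - (\<Sum>b\<in>B. \<iota> (c b) * b) \<in> P"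
    proof (rule ex_ex1I)
      show "\<exists>c. (\<forall>b. b \<notin> B \<longrightarrow> c b = 0) \<and> z - (\<Sum>b\<in>B. \<iota> (c b) * b) \<in> P"
        using c by (intro exI[of _ "\<lambda>b. if b \<in> B then c b else 0"]) simp
    next
      fix d d'
      assume d: "(\<forall>b. b \<notin> B \<longrightarrow> d b = 0) \<and> z - (\<Sum>b\<in>B. \<iota> (d b) * b) \<in> P"
        and d': "(\<forall>b. b \<notin> B \<longrightarrow> d' b = 0) \<and> z - (\<Sum>b\<in>B. \<iota> (d' b) * b) \<in> P"
      have "(z - (\<Sum>b\<in>B. \<iota> (d' b) * b)) - (z - (\<Sum>b\<in>B. \<iota> (d b) * b)) \<in> P"
        using d d' place_diff[OF P] by blast
      then have "(\<Sum>b\<in>B. \<iota> (d b - d' b) * b) \<in> P"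
        by (simp add: embed_diff left_diff_distrib sum_subtractf)
      moreover have "\<forall>c. (\<Sum>b\<in>B. \<iota> (c b) * b) \<in> P \<longrightarrow> (\<forall>b\<in>B. c b = 0)"
        using B(1) unfolding indep_def by blast
      ultimately have "\<forall>b\<in>B. d b - d' b = 0" by (auto dest: spec[of _ "\<lambda>b. d b - d' b"])
      then show "d = d'" using d d' by (intro ext) (metis eq_iff_diff_eq_0)
    qed
  qed
  then show ?thesis using that by blast
qed

lemma one_less_card_constants: "1 < card (UNIV :: 'q set)"
  using card_mono[of UNIV "{0, 1::'q}"] by simp

text \<open>Counting instead of an exchange argument: \<open>G\<close> turns coordinates with
  respect to \<open>B\<close> into coordinates with respect to \<open>B'\<close> of the same residue
  class. It is injective, so |K|^card B is at most |K|^card B'.\<close>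

lemma residue_basis_card_le:
  assumes P: "place \<iota> P" and B: "residue_basis \<iota> P B" and B': "residue_basis \<iota> P B'"
  shows "card B \<le> card B'"
proof -
  define X where "X B = B \<rightarrow>\<^sub>E (UNIV :: 'q set)" for B :: "'f set"
  have fin: "finite B" "finite B'" "B \<subseteq> ring_of_place P" "B' \<subseteq> ring_of_place P"
    using B B' by (auto simp: residue_basis_def)
  have uniq: "c = c'" if "\<forall>b. b \<notin> B \<longrightarrow> c b = 0" "z - (\<Sum>b\<in>B. \<iota> (c b) * b) \<in> P"
      "\<forall>b. b \<notin> B \<longrightarrow> c' b = 0" "z - (\<Sum>b\<in>B. \<iota> (c' b) * b) \<in> P" "z \<in> ring_of_place P" for z c c'
    using B that unfolding residue_basis_def by blast
  have "\<exists>g\<in>X B'. (\<Sum>b\<in>B. \<iota> (f b) * b) - (\<Sum>b\<in>B'. \<iota> (g b) * b) \<in> P" for f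
  proof -
    have "(\<Sum>b\<in>B. \<iota> (f b) * b) \<in> ring_of_place P"
      using fin by (intro place_ring_sum[OF P] place_ring_mult[OF P] place_ring_const[OF P]) auto
    then obtain c where "(\<Sum>b\<in>B. \<iota> (f b) * b) - (\<Sum>b\<in>B'. \<iota> (c b) * b) \<in> P"
      using B' unfolding residue_basis_def by blast
    then show ?thesis by (intro bexI[of _ "restrict c B'"]) (auto simp: X_def)
  qed
  then obtain G where G: "\<And>f. G f \<in> X B'" "\<And>f. (\<Sum>b\<in>B. \<iota> (f b) * b) - (\<Sum>b\<in>B'. \<iota> (G f b) * b) \<in> P"
    by metis
  have "inj_on G (X B)"
  proof (rule inj_onI)
    fix f f' assume f: "f \<in> X B" "f' \<in> X B" "G f = G f'"
    define z where "z = (\<Sum>b\<in>B'. \<iota> (G f b) * b)"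
    have zO: "z \<in> ring_of_place P"
      unfolding z_def using fin by (intro place_ring_sum[OF P] place_ring_mult[OF P] place_ring_const[OF P]) auto
    have *: "z - (\<Sum>b\<in>B. \<iota> (if b \<in> B then h b else 0) * b) \<in> P" if "G h = G f" for h
      using place_uminus[OF P G(2)[of h]] that by (simp add: z_def)
    have "(\<lambda>b. if b \<in> B then f b else 0) = (\<lambda>b. if b \<in> B then f' b else 0)"
      by (rule uniq[OF _ * _ * zO]) (use f in auto)
    then have "f b = f' b" if "b \<in> B" for b using that by (metis)
    then show "f = f'" using f(1,2) unfolding X_def by (intro PiE_ext)
  qed
  moreover have "G ` X B \<subseteq> X B'" using G(1) by blast
  ultimately have "card (X B) \<le> card (X B')"
    using fin by (intro card_inj_on_le[of G]) (auto simp: X_def intro: finite_PiE)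
  then have "card (UNIV :: 'q set) ^ card B \<le> card (UNIV :: 'q set) ^ card B'"
    using fin by (simp add: X_def card_funcsetE)
  then show ?thesis using one_less_card_constants power_le_imp_le_exp by blast
qed

text \<open>The one-element basis {b} need not be {1}. Writing 1 as c * b and z as d * b modulo P
  gives z congruent to d / c.\<close>

lemma rational_place_residue:
  assumes "rational_place \<iota> P" and z: "z \<in> ring_of_place P"
  obtains a where "z - \<iota> a \<in> P"
proof -
  have P: "place \<iota> P" and deg: "place_degree \<iota> P = 1" using assms(1) by (auto simp: rational_place_def)
  obtain B where B: "residue_basis \<iota> P B" using residue_basis_exists[OF P] .
  have "place_degree \<iota> P = card B"
    unfolding place_degree_def
    by (rule the_equality) (use B residue_basis_card_le[OF P] in \<open>auto intro: antisym\<close>)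
  then obtain b where b: "B = {b}" using deg by (metis card_1_singletonE)
  have ex: "\<exists>c. w - \<iota> c * b \<in> P" if "w \<in> ring_of_place P" for w
    using B that unfolding residue_basis_def b by fastforce
  obtain c where c: "1 - \<iota> c * b \<in> P" using ex[OF place_ring_one[OF P]] by blast
  obtain d where d: "z - \<iota> d * b \<in> P" using ex[OF z] by blast
  have c0: "c \<noteq> 0" using c place_one[OF P] by auto
  have "z - \<iota> d * b - (1 - \<iota> c * b) * \<iota> (d / c) \<in> P"
    by (rule place_diff[OF P d place_mult[OF P c place_ring_const[OF P]]])
  also have "z - \<iota> d * b - (1 - \<iota> c * b) * \<iota> (d / c) = z - \<iota> (d / c) + (\<iota> (c * (d / c)) - \<iota> d) * b"
    unfolding embed_mult by (simp add: algebra_simps)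
  finally have "z - \<iota> (d / c) \<in> P" using c0 by simp
  then show ?thesis using that by blast
qed

section \<open>Evaluation and power series expansions at rational places\<close>

lemma place_eval_eq:
  assumes P: "place \<iota> P" and a: "f - \<iota> a \<in> P"
  shows "place_eval \<iota> P f = a"
  unfolding place_eval_def
proof (rule the_equality)
  show "f - \<iota> a \<in> P" by (rule a)
  fix b assume "f - \<iota> b \<in> P"
  then have "(f - \<iota> a) - (f - \<iota> b) \<in> P" by (rule place_diff[OF P a])
  then have "\<iota> (b - a) \<in> P" by (simp add: embed_diff)
  then show "b = a" using place_const_iff[OF P] by simp
qed

lemma place_eval_residue:
  assumes "rational_place \<iota> P" and "f \<in> ring_of_place P"
  shows "f - \<iota> (place_eval \<iota> P f) \<in> P"
  using rational_place_residue[OF assms] place_eval_eq assms(1)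
  unfolding rational_place_def by metis

lemma valuation_ge_local_parameter_power:
  assumes P: "place \<iota> P" and t: "local_parameter P t"
  shows "valuation_ge P (t ^ n) (int n)"
  using valuation_ge_power[OF P, of t 1 n] valuation_ge_1_iff[OF P] local_parameter_in_place[OF P t] by simp

text \<open>Subtract the residue and divide by t, repeatedly. All remainders stay in the ring, and
  after N steps the error is t^N times the remainder.\<close>

lemma truncated_expansion_exists:
  assumes "rational_place \<iota> P" and t: "local_parameter P t" and u: "u \<in> ring_of_place P"
  obtains c where "\<And>N. valuation_ge P (u - (\<Sum>a<N. \<iota> (c a) * t ^ a)) (int N)"
proof -
  have P: "place \<iota> P" using assms(1) by (auto simp: rational_place_def)
  have t0: "t \<noteq> 0" using local_parameter_nonzero[OF P t] .
  define next_rem where "next_rem w = (w - \<iota> (place_eval \<iota> P w)) / t" for w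
  have next_O: "next_rem w \<in> ring_of_place P" if "w \<in> ring_of_place P" for w
    using place_eval_residue[OF assms(1) that] local_parameter_iff[OF t] t0 by (auto simp: next_rem_def)
  define rm where "rm N = (next_rem ^^ N) u" for N
  have rm_O: "rm N \<in> ring_of_place P" for N
    by (induction N) (auto simp: rm_def u next_O)
  define c where "c N = place_eval \<iota> P (rm N)" for N
  have eq: "u - (\<Sum>a<N. \<iota> (c a) * t ^ a) = t ^ N * rm N" for N
  proof (induction N)
    case (Suc N)
    have "t * rm (Suc N) = rm N - \<iota> (c N)"
      using t0 by (simp add: rm_def next_rem_def c_def)
    then have "t ^ Suc N * rm (Suc N) = t ^ N * (rm N - \<iota> (c N))"
      by (simp add: mult_ac)
    then show ?case using Suc by (simp add: algebra_simps)
  qed (simp add: rm_def)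
  have "valuation_ge P (u - (\<Sum>a<N. \<iota> (c a) * t ^ a)) (int N)" for N
    unfolding eq using valuation_ge_mult[OF P valuation_ge_local_parameter_power[OF P t, of N], of "rm N" 0]
      valuation_ge_0_iff[OF P] rm_O by simp
  then show ?thesis using that by blast
qed

text \<open>The integral quotient u / t^m is expanded and its coefficients are moved up by m
  places.\<close>

lemma power_expansion_exists:
  assumes "rational_place \<iota> P" and t: "local_parameter P t" and u: "valuation_ge P u (int m)"
  obtains c where "\<forall>a<m. c a = 0" and "power_expansion \<iota> P t c u"
proof -
  have P: "place \<iota> P" using assms(1) by (auto simp: rational_place_def)
  have t0: "t \<noteq> 0" using local_parameter_nonzero[OF P t] .
  have "u / t ^ m \<in> ring_of_place P"
    using u valuation_ge_iff[OF P t] by (simp add: power_int_minus field_simps)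
  then obtain d where d: "\<And>N. valuation_ge P (u / t ^ m - (\<Sum>a<N. \<iota> (d a) * t ^ a)) (int N)"
    using truncated_expansion_exists[OF assms(1) t] by blast
  define c where "c a = (if a < m then 0 else d (a - m))" for a
  have ge: "valuation_ge P (u - (\<Sum>a<N. \<iota> (c a) * t ^ a)) (int N)" if N: "m \<le> N" for N
  proof -
    obtain n where n: "N = m + n" using N le_Suc_ex by blast
    have "(\<Sum>a<m + n. \<iota> (c a) * t ^ a) = (\<Sum>a<n. \<iota> (c (m + a)) * t ^ (m + a))"
      by (induction n) (auto simp: c_def)
    also have "\<dots> = t ^ m * (\<Sum>a<n. \<iota> (d a) * t ^ a)"
      by (simp add: c_def sum_distrib_left power_add mult_ac)
    finally have "u - (\<Sum>a<N. \<iota> (c a) * t ^ a) = t ^ m * (u / t ^ m - (\<Sum>a<n. \<iota> (d a) * t ^ a))"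
      using t0 by (simp add: n right_diff_distrib)
    then show ?thesis
      using valuation_ge_mult[OF P valuation_ge_local_parameter_power[OF P t, of m] d[of n]] by (simp add: n)
  qed
  have "power_expansion \<iota> P t c u"
    unfolding power_expansion_def
  proof
    fix k
    show "\<forall>\<^sub>F N in sequentially. valuation_ge P (u - (\<Sum>a<N. \<iota> (c a) * t ^ a)) k"
      using eventually_ge_at_top[of "max m (nat k)"]
      by eventually_elim (rule valuation_ge_mono[OF ge], auto)
  qed
  then show ?thesis using that[of c] by (simp add: c_def)
qed

text \<open>\<open>T h\<close> lists the first m expansion coefficients. Equality of these words
  replaces m linear conditions on the difference, in the form that a pigeonhole argument
  needs.\<close>

lemma truncation_exists:
  assumes "rational_place \<iota> P"
  obtains T :: "'f \<Rightarrow> 'q list" where "\<And>h. length (T h) = m"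
    and "\<And>h h'. h \<in> ring_of_place P \<Longrightarrow> h' \<in> ring_of_place P \<Longrightarrow> T h = T h' \<Longrightarrow> valuation_ge P (h - h') (int m)"
proof -
  have P: "place \<iota> P" using assms by (auto simp: rational_place_def)
  obtain t where t: "local_parameter P t" using local_parameter_exists[OF P] .
  have "\<exists>c. h \<in> ring_of_place P \<longrightarrow> (\<forall>N. valuation_ge P (h - (\<Sum>a<N. \<iota> (c a) * t ^ a)) (int N))" for h
    using truncated_expansion_exists[OF assms t] by metis
  then obtain c where c: "\<And>h N. h \<in> ring_of_place P \<Longrightarrow> valuation_ge P (h - (\<Sum>a<N. \<iota> (c h a) * t ^ a)) (int N)"
    by metis
  show ?thesis
  proof (rule that[of "\<lambda>h. map (c h) [0..<m]"])
    fix h h' assume h: "h \<in> ring_of_place P" "h' \<in> ring_of_place P" "map (c h) [0..<m] = map (c h') [0..<m]"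
    then have "c h a = c h' a" if "a < m" for a using that by simp
    then have "(\<Sum>a<m. \<iota> (c h a) * t ^ a) = (\<Sum>a<m. \<iota> (c h' a) * t ^ a)" by simp
    then show "valuation_ge P (h - h') (int m)"
      using valuation_ge_diff[OF P c[OF h(1), of m] c[OF h(2), of m]] by simp
  qed simp
qed

subsection \<open>Zeros with multiplicity\<close>

text \<open>Multiplicity read through valuations: the coefficient of (z - r)^b needs order at least
  m - b. Natural subtraction gives 0 for b >= m, which still demands integrality, as an expansion
  without negative powers requires.\<close>

lemma zero_with_multiplicity_geI:
  assumes P: "rational_place \<iota> P"
    and ge: "\<And>b. valuation_ge P (coeff (pcompose Q [:\<iota> r, 1:]) b) (int (m - b))"
  shows "zero_with_multiplicity_ge \<iota> P r Q m"
proof -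
  obtain t where t: "local_parameter P t"
    using local_parameter_exists P by (auto simp: rational_place_def)
  have "\<exists>c. (\<forall>a<m - b. c a = 0) \<and> power_expansion \<iota> P t c (coeff (pcompose Q [:\<iota> r, 1:]) b)" for b
    using power_expansion_exists[OF P t ge] by metis
  then obtain c where "\<And>b. (\<forall>a<m - b. c b a = 0) \<and> power_expansion \<iota> P t (c b) (coeff (pcompose Q [:\<iota> r, 1:]) b)"
    by metis
  then show ?thesis
    unfolding zero_with_multiplicity_ge_def using t
    by (intro exI[of _ t] exI[of _ "\<lambda>a b. c b a"]) auto
qed

text \<open>Every term with nonzero coefficient has a >= m - b, and a long enough partial sum
  approximates the coefficient to that order, whichever local parameter the definition
  supplied.\<close>

lemma zero_with_multiplicity_geD:
  assumes P: "place \<iota> P" and zero: "zero_with_multiplicity_ge \<iota> P r Q m"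
  shows "valuation_ge P (coeff (pcompose Q [:\<iota> r, 1:]) b) (int (m - b))"
proof -
  obtain t c where t: "local_parameter P t" and c0: "\<And>a b. a + b < m \<Longrightarrow> c a b = 0"
    and exp: "\<And>b. power_expansion \<iota> P t (\<lambda>a. c a b) (coeff (pcompose Q [:\<iota> r, 1:]) b)"
    using zero unfolding zero_with_multiplicity_ge_def by blast
  define u where "u = coeff (pcompose Q [:\<iota> r, 1:]) b"
  obtain N where N: "valuation_ge P (u - (\<Sum>a<N. \<iota> (c a b) * t ^ a)) (int (m - b))"
    using exp[of b] unfolding power_expansion_def u_def eventually_sequentially by blast
  have "valuation_ge P (\<Sum>a<N. \<iota> (c a b) * t ^ a) (int (m - b))"
  proof (rule valuation_ge_sum[OF P])
    fix a
    show "valuation_ge P (\<iota> (c a b) * t ^ a) (int (m - b))"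
    proof (cases "a + b < m")
      case False
      then show ?thesis
        by (intro valuation_ge_const_mult[OF P] valuation_ge_mono[OF valuation_ge_local_parameter_power[OF P t]]) simp
    qed (simp add: c0)
  qed
  from valuation_ge_add[OF P N this] show ?thesis by (simp add: u_def)
qed

text \<open>In the expansion around r, the b-th term has order at least m - b from its coefficient
  and b from (f - r)^b.\<close>

lemma valuation_ge_poly_of_zero:
  assumes P: "place \<iota> P" and zero: "zero_with_multiplicity_ge \<iota> P r Q m" and f: "f - \<iota> r \<in> P"
  shows "valuation_ge P (poly Q f) (int m)"
proof -
  define R where "R = pcompose Q [:\<iota> r, 1:]"
  have "poly Q f = poly R (f - \<iota> r)" by (simp add: R_def poly_pcompose)
  also have "\<dots> = (\<Sum>b\<le>degree R. coeff R b * (f - \<iota> r) ^ b)" by (simp add: poly_altdef)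
  finally have eq: "poly Q f = (\<Sum>b\<le>degree R. coeff R b * (f - \<iota> r) ^ b)" .
  show ?thesis
    unfolding eq
  proof (rule valuation_ge_sum[OF P])
    fix b
    have "valuation_ge P (f - \<iota> r) 1" using f valuation_ge_1_iff[OF P] by simp
    then have "valuation_ge P ((f - \<iota> r) ^ b) (int b)" using valuation_ge_power[OF P, of _ 1 b] by simp
    with zero_with_multiplicity_geD[OF P zero, of b]
    have "valuation_ge P (coeff R b * (f - \<iota> r) ^ b) (int (m - b) + int b)"
      unfolding R_def by (rule valuation_ge_mult[OF P])
    then show "valuation_ge P (coeff R b * (f - \<iota> r) ^ b) (int m)" by (rule valuation_ge_mono) simp
  qed
qed

end

subsection \<open>Divisors\<close>

lemma divisor_degree_superset:
  assumes "finite S" "Poly_Mapping.keys A \<subseteq> S"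
  shows "divisor_degree \<iota> A = (\<Sum>P\<in>S. Poly_Mapping.lookup A P * int (place_degree \<iota> P))"
  unfolding divisor_degree_def
  using assms by (intro sum.mono_neutral_left) (auto simp: in_keys_iff)

lemma divisor_degree_add: "divisor_degree \<iota> (A + B) = divisor_degree \<iota> A + divisor_degree \<iota> B"
proof -
  have "finite (Poly_Mapping.keys A \<union> Poly_Mapping.keys B)" by simp
  from divisor_degree_superset[OF this, of "A + B" \<iota>] divisor_degree_superset[OF this, of A \<iota>]
    divisor_degree_superset[OF this, of B \<iota>]
  show ?thesis
    using Poly_Mapping.keys_add[of A B] by (simp add: lookup_add distrib_right sum.distrib)
qed

lemma divisor_degree_cmul: "divisor_degree \<iota> (frag_cmul k A) = k * divisor_degree \<iota> A"
  using divisor_degree_superset[of "Poly_Mapping.keys A" "frag_cmul k A" \<iota>] keys_cmul[of k A]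
  by (simp add: divisor_degree_def sum_distrib_left mult_ac)

lemma divisor_degree_diff: "divisor_degree \<iota> (A - B) = divisor_degree \<iota> A - divisor_degree \<iota> B"
  using divisor_degree_add[of \<iota> "A - B" B] by simp

lemma divisor_degree_single: "divisor_degree \<iota> (Poly_Mapping.single P k) = k * int (place_degree \<iota> P)"
  by (simp add: divisor_degree_def)

lemma divisor_degree_sum: "divisor_degree \<iota> (sum A I) = (\<Sum>i\<in>I. divisor_degree \<iota> (A i))"
proof (induction I rule: infinite_finite_induct)
  case (insert i I)
  then show ?case by (simp add: divisor_degree_add)
qed (simp_all add: divisor_degree_def)

lemma divisor_diff: "divisor \<iota> A \<Longrightarrow> divisor \<iota> B \<Longrightarrow> divisor \<iota> (A - B)"
  using keys_diff[of A B] unfolding divisor_def by blast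

lemma divisor_cmul: "divisor \<iota> A \<Longrightarrow> divisor \<iota> (frag_cmul k A)"
  using keys_cmul[of k A] unfolding divisor_def by blast

lemma divisor_single: "place \<iota> P \<Longrightarrow> divisor \<iota> (Poly_Mapping.single P k)"
  by (simp add: divisor_def)

lemma divisor_sum: "(\<And>i. i \<in> I \<Longrightarrow> divisor \<iota> (A i)) \<Longrightarrow> divisor \<iota> (sum A I)"
proof (induction I rule: infinite_finite_induct)
  case (insert i I)
  then show ?case using Poly_Mapping.keys_add[of "A i" "sum A I"] by (auto simp: divisor_def)
qed (simp_all add: divisor_def)

subsection \<open>Riemann--Roch spaces\<close>

context function_field
begin

lemma vector_space_embed: "vector_space (\<lambda>a z. \<iota> a * z)"
  by unfold_locales (simp_all add: algebra_simps embed_add embed_mult embed_one)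

interpretation vs: vector_space "\<lambda>a z. \<iota> a * z"
  by (rule vector_space_embed)

lemma riemann_roch_zero: "0 \<in> riemann_roch_space \<iota> A"
  by (simp add: riemann_roch_space_def)

lemma riemann_roch_add:
  "f \<in> riemann_roch_space \<iota> A \<Longrightarrow> h \<in> riemann_roch_space \<iota> A \<Longrightarrow> f + h \<in> riemann_roch_space \<iota> A"
  by (simp add: riemann_roch_space_def valuation_ge_add)

lemma riemann_roch_diff:
  "f \<in> riemann_roch_space \<iota> A \<Longrightarrow> h \<in> riemann_roch_space \<iota> A \<Longrightarrow> f - h \<in> riemann_roch_space \<iota> A"
  by (simp add: riemann_roch_space_def valuation_ge_diff)

lemma riemann_roch_uminus:
  "f \<in> riemann_roch_space \<iota> A \<Longrightarrow> - f \<in> riemann_roch_space \<iota> A"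
  by (simp add: riemann_roch_space_def valuation_ge_uminus)

lemma riemann_roch_const_mult:
  "f \<in> riemann_roch_space \<iota> A \<Longrightarrow> \<iota> c * f \<in> riemann_roch_space \<iota> A"
  by (simp add: riemann_roch_space_def valuation_ge_const_mult)

lemma riemann_roch_sum:
  "(\<And>i. i \<in> I \<Longrightarrow> f i \<in> riemann_roch_space \<iota> A) \<Longrightarrow> sum f I \<in> riemann_roch_space \<iota> A"
  by (induction I rule: infinite_finite_induct) (auto intro: riemann_roch_zero riemann_roch_add)

lemma riemann_roch_mult:
  assumes "f \<in> riemann_roch_space \<iota> A" "h \<in> riemann_roch_space \<iota> B"
  shows "f * h \<in> riemann_roch_space \<iota> (A + B)"
  using assms valuation_ge_mult
  by (fastforce simp: riemann_roch_space_def lookup_add)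

lemma riemann_roch_one: "1 \<in> riemann_roch_space \<iota> 0"
  by (simp add: riemann_roch_space_def valuation_ge_one)

lemma riemann_roch_power:
  assumes "f \<in> riemann_roch_space \<iota> A"
  shows "f ^ n \<in> riemann_roch_space \<iota> (frag_cmul (int n) A)"
proof (induction n)
  case (Suc n)
  then show ?case using riemann_roch_mult[OF assms Suc] by (simp add: frag_cmul_distrib)
qed (simp add: riemann_roch_one)

lemma riemann_roch_independent:
  obtains B where "B \<subseteq> riemann_roch_space \<iota> A" "finite B" "vs.independent B" "card B = riemann_roch_dim \<iota> A"
proof -
  obtain B where B: "B \<subseteq> riemann_roch_space \<iota> A" "vs.independent B" "card B = riemann_roch_dim \<iota> A"
    unfolding riemann_roch_dim_def by (rule vs.basis_exists)
  \<comment> \<open>The cardinality of an infinite set is 0, so in that case the empty set has the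
    required size.\<close>
  show ?thesis
  proof (cases "finite B")
    case False
    then show ?thesis using B(3) that[of "{}"] by (simp add: vs.independent_empty)
  qed (use B that in blast)
qed

text \<open>Turns a dimension into a number of elements, the quantity compared in the pigeonhole
  argument.\<close>

lemma riemann_roch_finite_subset:
  obtains T where "T \<subseteq> riemann_roch_space \<iota> A" "finite T" "card T = card (UNIV :: 'q set) ^ riemann_roch_dim \<iota> A"
proof -
  obtain B where B: "B \<subseteq> riemann_roch_space \<iota> A" "finite B" "vs.independent B" "card B = riemann_roch_dim \<iota> A"
    by (rule riemann_roch_independent)
  define X where "X = B \<rightarrow>\<^sub>E (UNIV :: 'q set)"
  define \<Phi> where "\<Phi> c = (\<Sum>b\<in>B. \<iota> (c b) * b)" for c
  have "inj_on \<Phi> X"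
  proof (rule inj_onI)
    fix c d assume cd: "c \<in> X" "d \<in> X" "\<Phi> c = \<Phi> d"
    then have "(\<Sum>b\<in>B. \<iota> (c b - d b) * b) = 0"
      by (simp add: \<Phi>_def embed_diff left_diff_distrib sum_subtractf)
    then have "c b - d b = 0" if "b \<in> B" for b
      using vs.independentD[OF B(3) B(2) order_refl _ that, of "\<lambda>b. c b - d b"] by blast
    then show "c = d" using cd(1,2) unfolding X_def by (intro PiE_ext) auto
  qed
  then have "card (\<Phi> ` X) = card (UNIV :: 'q set) ^ riemann_roch_dim \<iota> A"
    using B by (simp add: card_image X_def card_funcsetE)
  moreover have "\<Phi> ` X \<subseteq> riemann_roch_space \<iota> A"
    using B(1) by (auto simp: \<Phi>_def intro!: riemann_roch_sum riemann_roch_const_mult)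
  moreover have "finite (\<Phi> ` X)" using B(2) by (simp add: X_def finite_PiE)
  ultimately show ?thesis using that by blast
qed

text \<open>Multiplication by \<open>h ^ m\<close> embeds \<open>L(-(g + m) B)\<close> into the fixed finite-dimensional space
  \<open>L(-g B)\<close>, whereas the dimension of the former is unbounded by the definition of the genus.
  No product formula is needed.\<close>

lemma riemann_roch_negative_degree:
  assumes g: "has_genus \<iota> g" and B: "divisor \<iota> B" and deg: "divisor_degree \<iota> B < 0"
    and h: "h \<in> riemann_roch_space \<iota> B"
  shows "h = 0"
proof (rule ccontr)
  assume h0: "h \<noteq> 0"
  \<comment> \<open>Riemann's inequality for -kB, whose degree is at least k because deg B is a
    negative integer.\<close>
  have dim: "int k + 1 - int g \<le> int (riemann_roch_dim \<iota> (frag_cmul (- int k) B))" for k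
  proof -
    have "int k * 1 \<le> int k * - divisor_degree \<iota> B" using deg by (intro mult_left_mono) auto
    then have "int k \<le> divisor_degree \<iota> (frag_cmul (- int k) B)" by (simp add: divisor_degree_cmul)
    moreover have "divisor_degree \<iota> (frag_cmul (- int k) B)
        - int (riemann_roch_dim \<iota> (frag_cmul (- int k) B)) + 1 \<le> int g"
      using g divisor_cmul[OF B] unfolding has_genus_def by blast
    ultimately show ?thesis by linarith
  qed
  define V where "V = riemann_roch_space \<iota> (frag_cmul (- int g) B)"
  obtain B0 where B0: "V \<subseteq> vs.span B0" "card B0 = riemann_roch_dim \<iota> (frag_cmul (- int g) B)"
    unfolding V_def riemann_roch_dim_def by (rule vs.basis_exists)
  \<comment> \<open>\<open>dim\<close> at k = g gives at least 1, and a set of positive cardinality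
    is finite.\<close>
  have fin: "finite B0" using B0(2) dim[of g] by (intro card_ge_0_finite) simp
  define m where "m = card B0"
  \<comment> \<open>At k = g + m the inequality forces dimension at least m + 1, one more than the
    space containing the image can hold.\<close>
  obtain B1 where B1: "B1 \<subseteq> riemann_roch_space \<iota> (frag_cmul (- int (g + m)) B)" "vs.independent B1"
    "card B1 = riemann_roch_dim \<iota> (frag_cmul (- int (g + m)) B)"
    using riemann_roch_independent by metis
  have "B1 \<subseteq> vs.span ((\<lambda>b. b / h ^ m) ` B0)"
  proof
    fix v assume "v \<in> B1"
    then have "h ^ m * v \<in> riemann_roch_space \<iota> (frag_cmul (int m) B + frag_cmul (- int (g + m)) B)"
      using B1(1) by (intro riemann_roch_mult riemann_roch_power h) auto
    also have "frag_cmul (int m) B + frag_cmul (- int (g + m)) B = frag_cmul (- int g) B"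
      by (simp flip: frag_cmul_distrib)
    finally have "h ^ m * v \<in> vs.span B0" using B0(1) by (auto simp: V_def)
    then obtain c where c: "h ^ m * v = (\<Sum>b\<in>B0. \<iota> (c b) * b)"
      unfolding vs.span_finite[OF fin] by blast
    have "v = (h ^ m * v) / h ^ m" using h0 by simp
    also have "\<dots> = (\<Sum>b\<in>B0. \<iota> (c b) * (b / h ^ m))" unfolding c by (simp add: sum_divide_distrib)
    also have "\<dots> \<in> vs.span ((\<lambda>b. b / h ^ m) ` B0)"
      by (intro vs.span_sum vs.span_scale vs.span_base) auto
    finally show "v \<in> vs.span ((\<lambda>b. b / h ^ m) ` B0)" .
  qed
  then have "card B1 \<le> card ((\<lambda>b. b / h ^ m) ` B0)"
    using vs.independent_span_bound[OF _ B1(2)] fin by blast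
  also have "\<dots> \<le> m" unfolding m_def using fin by (rule card_image_le)
  finally show False using B1(3) dim[of "g + m"] by simp
qed

end

section \<open>Substituting powers into polynomials, and the support of D\<close>

lemma coeff_pcompose_monom_one:
  fixes A :: "'a::comm_ring_1 poly"
  assumes "0 < q"
  shows "coeff (pcompose A (monom 1 q)) b = (if q dvd b then coeff A (b div q) else 0)"
  using assms
proof (induction A arbitrary: b)
  case (pCons a A)
  have "coeff (pcompose (pCons a A) (monom 1 q)) b
      = (if b = 0 then a else 0) + (if q \<le> b then coeff (pcompose A (monom 1 q)) (b - q) else 0)"
    by (auto simp: pcompose_pCons coeff_monom_mult coeff_pCons split: nat.splits)
  also have "\<dots> = (if q dvd b then coeff (pCons a A) (b div q) else 0)"
  proof (cases "b < q")
    case True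
    then show ?thesis using pCons.prems by (auto dest: dvd_imp_le)
  next
    case False
    then have "q dvd b \<longleftrightarrow> q dvd (b - q)" "b div q = Suc ((b - q) div q)" "b \<noteq> 0"
      using pCons.prems by (auto simp: dvd_minus_self le_div_geq)
    then show ?thesis using False pCons by simp
  qed
  finally show ?case .
qed simp

lemma pcompose_sum_monom:
  fixes h :: "nat \<Rightarrow> 'a::comm_ring_1"
  shows "pcompose (\<Sum>j\<in>J. monom (h j) j) A = (\<Sum>j\<in>J. smult (h j) (A ^ j))"
proof -
  have "pcompose (monom c j) A = smult c (A ^ j)" for c j
    by (induction j) (simp_all add: monom_0 monom_Suc pcompose_pCons)
  then show ?thesis by (simp add: pcompose_sum)
qed

lemma lookup_sum_of_places: "Poly_Mapping.lookup (sum_of_places Ps) P = int (count_list Ps P)"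
  unfolding sum_of_places_def by (induction Ps) (auto simp: lookup_add)

lemma keys_sum_of_places: "Poly_Mapping.keys (sum_of_places Ps) = set Ps"
  by (auto simp: in_keys_iff lookup_sum_of_places count_list_0_iff)

context function_field
begin

section \<open>The Frobenius map, and regularity of functions at the evaluation places\<close>

lemma CHAR_function_field: "CHAR('f) = CHAR('q)"
proof (rule CHAR_eqI)
  show "of_nat CHAR('q) = (0 :: 'f)"
    using embed_of_nat[of "CHAR('q)"] by simp
  fix x assume "of_nat x = (0 :: 'f)"
  then have "of_nat x = (0 :: 'q)" using embed_of_nat[of x] by simp
  then show "CHAR('q) dvd x" by (simp add: of_nat_eq_0_iff_char_dvd)
qed

lemma prime_CHAR_constants: "prime CHAR('q)"
  by (intro prime_CHAR_semidom finite_imp_CHAR_pos) simp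

lemma frobenius_add: "(x + y :: 'f) ^ (CHAR('q) ^ e) = x ^ (CHAR('q) ^ e) + y ^ (CHAR('q) ^ e)"
  by (rule freshmans_dream') (simp_all add: CHAR_function_field prime_CHAR_constants)

text \<open>This is what keeps shifts of polynomials in z^q within polynomials in z^q, and so keeps
  the number of conditions at an error proportional to q.\<close>

lemma frobenius_linear_poly:
  "[:a :: 'f, 1:] ^ (CHAR('q) ^ e) = [:a ^ (CHAR('q) ^ e):] + monom 1 (CHAR('q) ^ e)"
proof -
  have "[:a, 1:] ^ (CHAR('q) ^ e) = ([:a:] + monom 1 1) ^ (CHAR('q) ^ e)"
    by (simp add: monom_Suc monom_0)
  also have "\<dots> = [:a:] ^ (CHAR('q) ^ e) + monom 1 1 ^ (CHAR('q) ^ e)"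
    by (rule freshmans_dream') (simp_all add: CHAR_function_field prime_CHAR_constants)
  finally show ?thesis by (simp add: monom_power poly_const_pow)
qed

lemma inj_frobenius: "inj (\<lambda>x :: 'f. x ^ (CHAR('q) ^ e))"
proof (rule injI)
  fix x y :: 'f assume "x ^ (CHAR('q) ^ e) = y ^ (CHAR('q) ^ e)"
  moreover have "(x - y) ^ (CHAR('q) ^ e) + y ^ (CHAR('q) ^ e) = x ^ (CHAR('q) ^ e)"
    by (simp flip: frobenius_add)
  ultimately show "x = y" by simp
qed

lemma riemann_roch_regular:
  assumes "f \<in> riemann_roch_space \<iota> A" and "disjoint_support A (sum_of_places Ps)"
    and "P \<in> set Ps" and P: "place \<iota> P"
  shows "f \<in> ring_of_place P"
proof -
  have "Poly_Mapping.lookup A P = 0"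
    using assms(2,3) by (auto simp: disjoint_support_def keys_sum_of_places in_keys_iff)
  then have "valuation_ge P f 0" using assms(1) P by (auto simp: riemann_roch_space_def)
  then show ?thesis using valuation_ge_0_iff[OF P] by simp
qed

subsection \<open>The powers of the ideal of a point\<close>

text \<open>The polynomials with these coefficient valuations form the \<open>m\<close>-th power of the ideal
  generated by a local parameter and \<open>z\<close>.\<close>

definition point_ideal :: "'f set \<Rightarrow> nat \<Rightarrow> 'f poly set" where
  "point_ideal P m = {A. \<forall>b. valuation_ge P (coeff A b) (int (m - b))}"

lemma point_ideal_mult:
  assumes P: "place \<iota> P" and A: "A \<in> point_ideal P m" and B: "B \<in> point_ideal P m'"
  shows "A * B \<in> point_ideal P (m + m')"
  unfolding point_ideal_def mem_Collect_eq coeff_mult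
proof (intro allI valuation_ge_sum[OF P])
  fix b i :: nat assume i: "i \<in> {..b}"
  \<comment> \<open>For i <= b, the truncated differences m - i and m' - (b - i) add up to at least
    m + m' - b.\<close>
  have "valuation_ge P (coeff A i * coeff B (b - i)) (int (m - i) + int (m' - (b - i)))"
    using A B by (intro valuation_ge_mult[OF P]) (auto simp: point_ideal_def)
  then show "valuation_ge P (coeff A i * coeff B (b - i)) (int (m + m' - b))"
    using i by (elim valuation_ge_mono) auto
qed

lemma point_ideal_sum:
  assumes P: "place \<iota> P" and "\<And>i. i \<in> I \<Longrightarrow> A i \<in> point_ideal P m"
  shows "sum A I \<in> point_ideal P m"
  using assms(2) by (auto simp: point_ideal_def coeff_sum intro: valuation_ge_sum[OF P])

lemma point_ideal_power:
  assumes P: "place \<iota> P" and A: "A \<in> point_ideal P m"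
  shows "A ^ n \<in> point_ideal P (n * m)"
proof (induction n)
  case 0
  then show ?case by (auto simp: point_ideal_def coeff_1 valuation_ge_one[OF P])
next
  case (Suc n)
  show ?case using point_ideal_mult[OF P A Suc] by simp
qed

lemma point_ideal_mono: "m' \<le> m \<Longrightarrow> A \<in> point_ideal P m \<Longrightarrow> A \<in> point_ideal P m'"
  unfolding point_ideal_def by (intro CollectI allI, rule valuation_ge_mono) auto

lemma point_ideal_const: "valuation_ge P h (int m) \<Longrightarrow> [:h:] \<in> point_ideal P m"
  by (auto simp: point_ideal_def coeff_pCons split: nat.splits)

lemma point_ideal_smult:
  assumes P: "place \<iota> P" and "valuation_ge P h (int m)" and "A \<in> point_ideal P m'"
  shows "smult h A \<in> point_ideal P (m + m')"
  using point_ideal_mult[OF P point_ideal_const assms(3)] assms(2) by simp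

lemma point_ideal_linear_0:
  assumes P: "place \<iota> P" and "a \<in> ring_of_place P"
  shows "[:a, 1:] \<in> point_ideal P 0"
  using assms(2)
  by (auto simp: point_ideal_def coeff_pCons valuation_ge_0_iff[OF P] place_ring_one[OF P] place_ring_zero[OF P] split: nat.splits)

lemma point_ideal_linear_1:
  assumes P: "place \<iota> P" and "a \<in> P"
  shows "[:a, 1:] \<in> point_ideal P 1"
  using assms(2)
  by (auto simp: point_ideal_def coeff_pCons valuation_ge_1_iff[OF P] valuation_ge_0_iff[OF P] place_ring_one[OF P] place_ring_zero[OF P]
      split: nat.splits)

text \<open>Replaces solving a homogeneous linear system with \<Sum> m i equations. \<open>F\<close>
  is not assumed additive here: the conclusion bounds differences of values, which the application
  identifies with the value at the difference tuple.\<close>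

lemma pigeonhole_valuations:
  fixes F :: "'i \<Rightarrow> 'x \<Rightarrow> 'f"
  assumes I: "finite I" and X: "finite X"
    and rational: "\<And>i. i \<in> I \<Longrightarrow> rational_place \<iota> (P i)"
    and ring: "\<And>i x. i \<in> I \<Longrightarrow> x \<in> X \<Longrightarrow> F i x \<in> ring_of_place (P i)"
    and card: "card (UNIV :: 'q set) ^ (\<Sum>i\<in>I. m i) < card X"
  obtains x y where "x \<in> X" "y \<in> X" "x \<noteq> y" "\<And>i. i \<in> I \<Longrightarrow> valuation_ge (P i) (F i x - F i y) (int (m i))"
proof -
  have "\<exists>T :: 'f \<Rightarrow> 'q list. (\<forall>h. length (T h) = m i) \<and>
      (\<forall>h\<in>ring_of_place (P i). \<forall>h'\<in>ring_of_place (P i). T h = T h' \<longrightarrow> valuation_ge (P i) (h - h') (int (m i)))"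
    if "i \<in> I" for i
    using truncation_exists[OF rational[OF that], of "m i"] by metis
  then obtain T :: "'i \<Rightarrow> 'f \<Rightarrow> 'q list" where
    len: "\<And>i h. i \<in> I \<Longrightarrow> length (T i h) = m i" and
    T: "\<And>i h h'. i \<in> I \<Longrightarrow> h \<in> ring_of_place (P i) \<Longrightarrow> h' \<in> ring_of_place (P i) \<Longrightarrow>
       T i h = T i h' \<Longrightarrow> valuation_ge (P i) (h - h') (int (m i))"
    by metis
  define \<Phi> where "\<Phi> x = restrict (\<lambda>i. T i (F i x)) I" for x
  define Y where "Y = (\<Pi>\<^sub>E i\<in>I. {xs :: 'q list. length xs = m i})"
  have fin: "finite {xs :: 'q list. length xs = k}" and cl: "card {xs :: 'q list. length xs = k} = card (UNIV :: 'q set) ^ k" for k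
    using finite_lists_length_eq[of "UNIV :: 'q set" k] card_lists_length_eq[of "UNIV :: 'q set" k] by simp_all
  have "finite Y" unfolding Y_def by (intro finite_PiE I fin)
  moreover have "card Y = card (UNIV :: 'q set) ^ (\<Sum>i\<in>I. m i)"
    unfolding Y_def by (simp add: card_PiE I cl power_sum)
  moreover have "\<Phi> ` X \<subseteq> Y" by (auto simp: \<Phi>_def Y_def len)
  ultimately have "card (\<Phi> ` X) < card X" using card card_mono le_less_trans by metis
  then have "\<not> inj_on \<Phi> X" using card_image by fastforce
  then obtain x y where xy: "x \<in> X" "y \<in> X" "x \<noteq> y" "\<Phi> x = \<Phi> y" by (auto simp: inj_on_def)
  have "valuation_ge (P i) (F i x - F i y) (int (m i))" if i: "i \<in> I" for i
    using T[OF i ring[OF i xy(1)] ring[OF i xy(2)]] fun_cong[OF xy(4), of i] i by (simp add: \<Phi>_def)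
  then show ?thesis using that xy by blast
qed

subsection \<open>Interpolation polynomials\<close>

lemma interpolation_polynomial_root:
  assumes g: "has_genus \<iota> g" and distinct: "distinct Ps"
    and rational: "\<forall>P\<in>set Ps. rational_place \<iota> P"
    and G: "disjoint_support G (sum_of_places Ps)"
    and len: "length r = length Ps"
    and A: "admissible_divisor \<iota> Ps s e \<tau> A"
    and Q: "interpolation_polynomial \<iota> Ps G s l e A r Q"
    and f: "f \<in> close_functions \<iota> Ps G \<tau> r"
  shows "poly Q f = 0"
proof -
  define n where "n = length Ps"
  define q where "q = CHAR('q) ^ e"
  define I where "I = {i. i < n \<and> codeword \<iota> Ps f ! i = r ! i}"
  \<comment> \<open>Records the forced zeros of Q(f): order q * s at each position where f agrees
    with r.\<close>
  define B where "B = A - (\<Sum>i\<in>I. Poly_Mapping.single (Ps ! i) (int (q * s)))"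
  have place: "place \<iota> (Ps ! i)" "rational_place \<iota> (Ps ! i)" if "i < n" for i
    using rational that by (auto simp: n_def rational_place_def)
  have fG: "f \<in> riemann_roch_space \<iota> G" and dist: "hamming_distance (codeword \<iota> Ps f) r \<le> \<tau>"
    using f by (auto simp: close_functions_def)
  have A': "divisor \<iota> A" "disjoint_support A (sum_of_places Ps)"
    "divisor_degree \<iota> A = int q * int s * (int n - int \<tau>) - 1"
    using A by (auto simp: admissible_divisor_def n_def q_def)
  obtain Qc where Qc: "Q = (\<Sum>j\<le>l. monom (Qc j) (q * j))"
      "\<And>j. j \<le> l \<Longrightarrow> Qc j \<in> riemann_roch_space \<iota> (A - frag_cmul (int (q * j)) G)"
    and zero: "\<And>i. i < n \<Longrightarrow> zero_with_multiplicity_ge \<iota> (Ps ! i) (r ! i) Q (q * s)"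
    using Q unfolding interpolation_polynomial_def q_def n_def by blast
  have "poly Q f = (\<Sum>j\<le>l. Qc j * f ^ (q * j))"
    by (simp add: Qc(1) poly_sum poly_monom)
  also have "\<dots> \<in> riemann_roch_space \<iota> A"
  proof (rule riemann_roch_sum)
    fix j assume "j \<in> {..l}"
    then have "Qc j * f ^ (q * j) \<in> riemann_roch_space \<iota> (A - frag_cmul (int (q * j)) G + frag_cmul (int (q * j)) G)"
      by (intro riemann_roch_mult riemann_roch_power fG Qc(2)) simp
    then show "Qc j * f ^ (q * j) \<in> riemann_roch_space \<iota> A" by simp
  qed
  finally have QA: "poly Q f \<in> riemann_roch_space \<iota> A" .
  have valI: "valuation_ge (Ps ! i) (poly Q f) (int (q * s))" if i: "i \<in> I" for i
  proof (rule valuation_ge_poly_of_zero)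
    have i': "i < n" "place_eval \<iota> (Ps ! i) f = r ! i" using i by (auto simp: I_def codeword_def n_def)
    show "place \<iota> (Ps ! i)" "zero_with_multiplicity_ge \<iota> (Ps ! i) (r ! i) Q (q * s)"
      using place zero i' by auto
    have "f \<in> ring_of_place (Ps ! i)"
      using riemann_roch_regular[OF fG G _ place(1)] i'(1) by (simp add: n_def)
    then show "f - \<iota> (r ! i) \<in> Ps ! i" using place_eval_residue[OF place(2)] i' by metis
  qed
  have finI: "finite I" by (simp add: I_def)
  have "poly Q f \<in> riemann_roch_space \<iota> B"
    unfolding riemann_roch_space_def
  proof (intro CollectI allI impI)
    fix P assume P: "place \<iota> P"
    have lookup: "Poly_Mapping.lookup B P = Poly_Mapping.lookup A P - (\<Sum>i\<in>I. if Ps ! i = P then int (q * s) else 0)"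
      by (simp add: B_def lookup_minus lookup_sum lookup_single when_def del: of_nat_mult)
    show "valuation_ge P (poly Q f) (- Poly_Mapping.lookup B P)"
    proof (cases "\<exists>i\<in>I. Ps ! i = P")
      case True
      then obtain i where i: "i \<in> I" "Ps ! i = P" by blast
      \<comment> \<open>Distinctness of the places ensures that q * s is subtracted only once at
        P.\<close>
      have "Ps ! j = P \<longleftrightarrow> j = i" if "j \<in> I" for j
        using that i nth_eq_iff_index_eq[OF distinct, of j i] by (auto simp: I_def n_def)
      then have "(\<Sum>j\<in>I. if Ps ! j = P then int (q * s) else 0) = (\<Sum>j\<in>I. if j = i then int (q * s) else 0)"
        by (intro sum.cong) auto
      also have "\<dots> = int (q * s)" using i finI by simp
      moreover have "Poly_Mapping.lookup A P = 0"
        using A'(2) i by (auto simp: disjoint_support_def keys_sum_of_places in_keys_iff I_def n_def)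
      ultimately show ?thesis using lookup valI[OF i(1)] i(2) by simp
    next
      case False
      then have "(\<Sum>j\<in>I. if Ps ! j = P then int (q * s) else 0) = 0" by (intro sum.neutral) auto
      then show ?thesis using lookup QA P by (simp add: riemann_roch_space_def)
    qed
  qed
  moreover have "divisor \<iota> B"
    unfolding B_def by (intro divisor_diff divisor_sum divisor_single A' place) (simp add: I_def)
  \<comment> \<open>At least n - \<tau> agreements remove q * s each from deg A = q * s * (n -
    \<tau>) - 1; the final -1 makes the result negative.\<close>
  moreover have "divisor_degree \<iota> B < 0"
  proof -
    have "(\<Sum>i\<in>I. int (q * s) * int (place_degree \<iota> (Ps ! i))) = (\<Sum>i\<in>I. int (q * s))"
      by (intro sum.cong) (use place in \<open>auto simp: I_def rational_place_def\<close>)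
    then have "divisor_degree \<iota> B = int q * int s * (int n - int \<tau>) - 1 - int (card I) * int (q * s)"
      by (simp add: B_def divisor_degree_diff divisor_degree_sum divisor_degree_single A'(3))
    moreover have "n \<le> card I + \<tau>"
    proof -
      have "{..<n} = I \<union> {i. i < n \<and> codeword \<iota> Ps f ! i \<noteq> r ! i}" by (auto simp: I_def)
      then have "card {..<n} \<le> card I + card {i. i < n \<and> codeword \<iota> Ps f ! i \<noteq> r ! i}"
        by (metis card_Un_le)
      then show ?thesis using dist by (simp add: hamming_distance_def codeword_def n_def)
    qed
    then have "int (q * s) * (int n - int \<tau>) \<le> int (q * s) * int (card I)"
      by (intro mult_left_mono) auto
    ultimately show ?thesis by (simp add: mult_ac)
  qed
  ultimately show ?thesis using riemann_roch_negative_degree[OF g] by blast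
qed

lemma interpolation_polynomial_roots_card:
  assumes "interpolation_polynomial \<iota> Ps G s l e A r Q"
  shows "finite {f. poly Q f = 0}" and "card {f. poly Q f = 0} \<le> l"
proof -
  define q where "q = CHAR('q) ^ e"
  obtain Qc where Qc: "Q = (\<Sum>j\<le>l. monom (Qc j) (q * j))" and Q0: "Q \<noteq> 0"
    using assms unfolding interpolation_polynomial_def q_def by blast
  \<comment> \<open>Q(z) = R(z^q), so the q-th powers of the roots of Q are roots of a nonzero
    polynomial of degree at most l.\<close>
  define R where "R = (\<Sum>j\<le>l. monom (Qc j) j)"
  have "poly Q f = poly R (f ^ q)" for f
    by (simp add: Qc R_def poly_sum poly_monom power_mult)
  then have img: "(\<lambda>f. f ^ q) ` {f. poly Q f = 0} \<subseteq> {y. poly R y = 0}" by auto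
  have "R \<noteq> 0"
  proof
    assume "R = 0"
    then have "Qc j = 0" if "j \<le> l" for j
      using that coeff_sum_monom[of j l Qc] by (simp add: R_def)
    then show False using Q0 by (simp add: Qc)
  qed
  have "degree R \<le> l" unfolding R_def by (intro degree_sum_le) (auto intro: order_trans[OF degree_monom_le])
  have inj: "inj_on (\<lambda>f. f ^ q) {f. poly Q f = 0}"
    unfolding q_def using inj_frobenius by (rule inj_on_subset) simp
  show "finite {f. poly Q f = 0}"
    using finite_imageD[OF finite_subset[OF img poly_roots_finite[OF \<open>R \<noteq> 0\<close>]] inj] .
  have "card {f. poly Q f = 0} \<le> card {y. poly R y = 0}"
    using card_inj_on_le[OF inj img poly_roots_finite[OF \<open>R \<noteq> 0\<close>]] .
  also have "\<dots> \<le> l" using card_poly_roots_bound[OF \<open>R \<noteq> 0\<close>] \<open>degree R \<le> l\<close> by simp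
  finally show "card {f. poly Q f = 0} \<le> l" .
qed

end

section \<open>Arithmetic sums for counting the conditions\<close>

lemma sum_lessThan_diff: "2 * (\<Sum>j<s. int (s - j)) = int s * (int s + 1)"
proof -
  \<comment> \<open>The offset \<open>m\<close> makes the induction go through: splitting off the
    last term, m + 1, leaves the shorter sum with offset m + 1.\<close>
  have "2 * (\<Sum>j<s. int (m + s - j)) = int s * (2 * int m + int s + 1)" for m
  proof (induction s arbitrary: m)
    case (Suc s)
    have "(\<Sum>j<Suc s. int (m + Suc s - j)) = (\<Sum>j<s. int (Suc m + s - j)) + int (Suc m)"
      by simp
    then show ?case using Suc[of "Suc m"] by (simp add: algebra_simps)
  qed simp
  from this[of 0] show ?thesis by simp
qed

lemma sum_atLeast1_lessThan_diff:
  assumes "1 \<le> s"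
  shows "2 * (\<Sum>j\<in>{1..<s}. int (s - j)) = int s * (int s - 1)"
proof -
  have "{..<s} = insert 0 {1..<s}" using assms by auto
  then have "(\<Sum>j<s. int (s - j)) = int s + (\<Sum>j\<in>{1..<s}. int (s - j))" by simp
  then show ?thesis using sum_lessThan_diff[of s] by (simp add: algebra_simps)
qed

context function_field
begin

text \<open>In \<open>bound\<close> both sides are doubled to avoid halves. The left is an upper
  bound for the conditions, q * s * (s - 1) / 2 at each position plus q * s more at each error. The
  right sums deg (A - q * j * G) + 1 - g over j = 1, ..., l, where the -1 in deg A cancels the
  +1.\<close>

lemma interpolation_polynomial_exists:
  fixes g s l e \<tau> :: nat
  assumes g: "has_genus \<iota> g" and rational: "\<forall>P\<in>set Ps. rational_place \<iota> P"
    and G: "divisor \<iota> G" "disjoint_support G (sum_of_places Ps)"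
    and len: "length r = length Ps"
    and A: "admissible_divisor \<iota> Ps s e \<tau> A"
    and f: "f \<in> close_functions \<iota> Ps G \<tau> r"
    and s: "1 \<le> s" "s \<le> l"
    and bound: "int (CHAR('q) ^ e) * (int (length Ps) * int s * (int s - 1) + 2 * int s * int \<tau>) <
      2 * int l * (int (CHAR('q) ^ e) * int s * (int (length Ps) - int \<tau>) - int g)
      - int (CHAR('q) ^ e) * int l * (int l + 1) * divisor_degree \<iota> G"
  shows "\<exists>Q. interpolation_polynomial \<iota> Ps G s l e A r Q"
proof -
  define n where "n = length Ps"
  define q where "q = CHAR('q) ^ e"
  have q: "0 < q" using prime_gt_0_nat[OF prime_CHAR_constants] by (simp add: q_def)
  define E where "E = {i. i < n \<and> codeword \<iota> Ps f ! i \<noteq> r ! i}"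
  have place: "place \<iota> (Ps ! i)" "rational_place \<iota> (Ps ! i)" "Ps ! i \<in> set Ps" if "i < n" for i
    using rational that by (auto simp: n_def rational_place_def)
  have fG: "f \<in> riemann_roch_space \<iota> G" and dist: "card E \<le> \<tau>"
    using f by (auto simp: close_functions_def hamming_distance_def codeword_def E_def n_def)
  have A': "divisor \<iota> A" "disjoint_support A (sum_of_places Ps)"
    "divisor_degree \<iota> A = int q * int s * (int n - int \<tau>) - 1"
    using A by (auto simp: admissible_divisor_def n_def q_def)
  have f_ring: "f \<in> ring_of_place (Ps ! i)" if "i < n" for i
    using riemann_roch_regular[OF fG G(2)] place that by blast
  define L where "L j = riemann_roch_space \<iota> (A - frag_cmul (int (q * j)) G)" for j
  have L_ring: "h \<in> ring_of_place (Ps ! i)" if "i < n" "h \<in> L j" for i j h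
  proof (rule riemann_roch_regular[OF that(2)[unfolded L_def] _ place(3)[OF that(1)] place(1)[OF that(1)]])
    show "disjoint_support (A - frag_cmul (int (q * j)) G) (sum_of_places Ps)"
      using A'(2) G(2) keys_diff[of A "frag_cmul (int (q * j)) G"] keys_cmul[of "int (q * j)" G]
      unfolding disjoint_support_def by blast
  qed
  define N where "N j = riemann_roch_dim \<iota> (A - frag_cmul (int (q * j)) G)" for j
  have "\<exists>T. T \<subseteq> L j \<and> finite T \<and> card T = card (UNIV :: 'q set) ^ N j" for j
    unfolding L_def N_def by (metis riemann_roch_finite_subset)
  then obtain T where T: "\<And>j. T j \<subseteq> L j" "\<And>j. finite (T j)" "\<And>j. card (T j) = card (UNIV :: 'q set) ^ N j"
    by metis
  \<comment> \<open>Tuples (h_1, ..., h_l) of candidate coefficients, each drawn from a finite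
    subset of L(A - q * j * G) of size |K|^(N j).\<close>
  define X where "X = (\<Pi>\<^sub>E j\<in>{1..l}. T j)"
  have X_L: "h j \<in> L j" if "h \<in> X" "j \<in> {1..l}" for h j
    using that T(1) unfolding X_def by (blast dest: PiE_mem)
  have card_X: "card X = card (UNIV :: 'q set) ^ (\<Sum>j=1..l. N j)"
    unfolding X_def by (simp add: card_PiE T(3) power_sum)
  have fin_X: "finite X" unfolding X_def by (intro finite_PiE T(2)) simp

  \<comment> \<open>\<open>H\<close> encodes a tuple as a polynomial in w. Putting w = (z - f)^q
    gives \<open>Q\<close>, and putting w - f^q for w gives \<open>R\<close>, so that Q(z) = R(z^q)
    by Frobenius. The required coefficients Q_k are those of \<open>R\<close>.\<close>
  define H where "H h = (\<Sum>j=1..l. monom (h j) j)" for h :: "nat \<Rightarrow> 'f"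
  define Q where "Q h = pcompose (H h) ([:- f, 1:] ^ q)" for h
  define R where "R h = pcompose (H h) [:(- f) ^ q, 1:]" for h
  have pcompose_linear: "[:c, 1:] \<circ>\<^sub>p B = [:c:] + B" for c :: 'f and B
    by (simp add: pcompose_pCons)
  have pcompose_pow: "(B ^ k) \<circ>\<^sub>p C = (B \<circ>\<^sub>p C) ^ k" for B C :: "'f poly" and k
    by (induction k) (simp_all add: pcompose_mult pcompose_1)
  have Q_R: "Q h = pcompose (R h) (monom 1 q)" for h
    by (simp add: Q_def R_def pcompose_linear frobenius_linear_poly q_def flip: pcompose_assoc)
  have Q_shift: "pcompose (Q h) [:\<iota> a, 1:] = pcompose (H h) ([:\<iota> a - f, 1:] ^ q)" for h a
  proof -
    have "[:- f, 1:] \<circ>\<^sub>p [:\<iota> a, 1:] = [:\<iota> a - f, 1:]" by (simp add: pcompose_linear)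
    then show ?thesis by (simp add: Q_def pcompose_pow flip: pcompose_assoc)
  qed
  \<comment> \<open>Two views of the polynomial shifted to r_i: this sum shows integrality and
    serves at agreements, while the Frobenius form shows at errors that only exponents divisible by
    q occur.\<close>
  have Q_shift_sum: "pcompose (Q h) [:\<iota> a, 1:] = (\<Sum>j=1..l. smult (h j) ([:\<iota> a - f, 1:] ^ (q * j)))" for h a
    unfolding Q_shift H_def pcompose_sum_monom by (simp add: power_mult)
  have Q_shift_Frobenius: "pcompose (Q h) [:\<iota> a, 1:]
      = pcompose (pcompose (H h) [:(\<iota> a - f) ^ q, 1:]) (monom 1 q)" for h a
    unfolding Q_shift by (simp add: pcompose_linear frobenius_linear_poly q_def flip: pcompose_assoc)
  have shift_ring: "pcompose (Q h) [:\<iota> (r ! i), 1:] \<in> point_ideal (Ps ! i) 0"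
    if "i < n" "\<And>j. j \<in> {1..l} \<Longrightarrow> h j \<in> L j" for h i
    unfolding Q_shift_sum
  proof (rule point_ideal_sum[OF place(1)[OF that(1)]])
    fix j assume "j \<in> {1..l}"
    then have "h j \<in> ring_of_place (Ps ! i)" using L_ring that by blast
    then have "valuation_ge (Ps ! i) (h j) (int 0)"
      using valuation_ge_0_iff[OF place(1)[OF that(1)]] by simp
    moreover have "[:\<iota> (r ! i) - f, 1:] \<in> point_ideal (Ps ! i) 0"
      using place(1)[OF that(1)] f_ring[OF that(1)]
      by (intro point_ideal_linear_0 place_ring_diff place_ring_const)
    ultimately show "smult (h j) ([:\<iota> (r ! i) - f, 1:] ^ (q * j)) \<in> point_ideal (Ps ! i) 0"
      using point_ideal_smult[OF place(1)[OF that(1)], of "h j" 0 _ 0]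
        point_ideal_power[OF place(1)[OF that(1)], of "[:\<iota> (r ! i) - f, 1:]" 0 "q * j"] by simp
  qed

  \<comment> \<open>One condition per pair (i, j), of order q * (s - j). At an error it concerns the
    coefficient of z^(q * j) in the shifted polynomial; at an agreement it concerns h_j itself, and
    j = 0 is absent because the tuples start at 1.\<close>
  define I where "I = (SIGMA i:{..<n}. if i \<in> E then {..<s} else {1..<s})"
  define F where "F = (\<lambda>(i, j) h. if i \<in> E then coeff (pcompose (Q h) [:\<iota> (r ! i), 1:]) (q * j) else h j)"
  define m where "m = (\<lambda>(i :: nat, j). q * (s - j))"
  have less: "(\<Sum>k\<in>I. m k) < (\<Sum>j=1..l. N j)"
  proof -
    define dG where "dG = divisor_degree \<iota> G"
    have inner: "2 * (\<Sum>j\<in>(if i \<in> E then {..<s} else {1..<s}). int (s - j))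
        = int s * (int s - 1) + (if i \<in> E then 2 * int s else 0)" for i
      using sum_lessThan_diff[of s] sum_atLeast1_lessThan_diff[OF s(1)] by (simp add: algebra_simps)
    have "2 * int (\<Sum>k\<in>I. m k) = (\<Sum>i<n. int q * (2 * (\<Sum>j\<in>(if i \<in> E then {..<s} else {1..<s}). int (s - j))))"
      unfolding I_def m_def by (subst sum.Sigma[symmetric]) (auto simp: sum_distrib_left mult_ac)
    also have "\<dots> = (\<Sum>i<n. int q * (int s * (int s - 1)) + (if i \<in> E then int q * (2 * int s) else 0))"
      unfolding inner by (intro sum.cong) (simp_all add: algebra_simps)
    also have "\<dots> = int n * (int q * (int s * (int s - 1))) + (\<Sum>i\<in>{..<n} \<inter> E. int q * (2 * int s))"
      unfolding sum.distrib by (subst sum.inter_restrict) simp_all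
    also have "{..<n} \<inter> E = E" by (auto simp: E_def)
    also have "(\<Sum>i\<in>E. int q * (2 * int s)) = int (card E) * (int q * (2 * int s))" by simp
    also have "\<dots> \<le> int \<tau> * (int q * (2 * int s))"
      using dist by (intro mult_right_mono) auto
    finally have 1: "2 * int (\<Sum>k\<in>I. m k) \<le> int q * (int n * int s * (int s - 1) + 2 * int s * int \<tau>)"
      by (simp add: algebra_simps)
    \<comment> \<open>This is deg A + 1 - g, the part of the dimension bound that does not depend on
      j.\<close>
    define c where "c = int q * int s * (int n - int \<tau>) - int g"
    have dim: "c - int q * dG * int j \<le> int (N j)" for j
    proof -
      have "divisor_degree \<iota> (A - frag_cmul (int (q * j)) G) - int (N j) + 1 \<le> int g"
        using g divisor_diff[OF A'(1) divisor_cmul[OF G(1)]] unfolding has_genus_def N_def by blast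
      then show ?thesis
        by (simp add: divisor_degree_diff divisor_degree_cmul A'(3) dG_def c_def mult_ac)
    qed
    have gauss: "2 * (\<Sum>j=1..l. int j) = int l * (int l + 1)"
      by (induction l) (simp_all add: algebra_simps)
    have "2 * int l * (int q * int s * (int n - int \<tau>) - int g) - int q * int l * (int l + 1) * dG
        = 2 * (int l * (int q * int s * (int n - int \<tau>) - int g)) - int q * dG * (2 * (\<Sum>j=1..l. int j))"
      unfolding gauss by (simp add: algebra_simps)
    also have "\<dots> = 2 * (\<Sum>j=1..l. c - int q * dG * int j)"
      by (simp add: sum_subtractf c_def flip: sum_distrib_left)
    also have "\<dots> \<le> 2 * (\<Sum>j=1..l. int (N j))"
      by (intro mult_left_mono sum_mono dim) simp
    finally have "2 * int (\<Sum>k\<in>I. m k) < 2 * (\<Sum>j=1..l. int (N j))"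
      using 1 bound unfolding n_def q_def dG_def by linarith
    then have "int (\<Sum>k\<in>I. m k) < int (\<Sum>j=1..l. N j)" by simp
    then show ?thesis by (simp only: of_nat_less_iff)
  qed
  have I_n: "fst k < n" if "k \<in> I" for k using that by (auto simp: I_def)
  have F_ring: "F k h \<in> ring_of_place (Ps ! fst k)" if k: "k \<in> I" and h: "h \<in> X" for k h
  proof -
    obtain i j where ij: "k = (i, j)" by fastforce
    have i: "i < n" and j: "j < s" "i \<notin> E \<Longrightarrow> 1 \<le> j" using k by (auto simp: I_def ij split: if_splits)
    show ?thesis
    proof (cases "i \<in> E")
      case True
      then show ?thesis
        using shift_ring[OF i X_L[OF h]] valuation_ge_0_iff[OF place(1)[OF i]]
        by (simp add: F_def ij point_ideal_def)
    next
      case False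
      then have "h j \<in> L j" using j s by (intro X_L[OF h]) auto
      then show ?thesis using False L_ring[OF i] by (simp add: F_def ij)
    qed
  qed
  have "finite I" unfolding I_def by auto
  moreover have "card (UNIV :: 'q set) ^ (\<Sum>k\<in>I. m k) < card X"
    unfolding card_X using one_less_card_constants less by (intro power_strict_increasing)
  ultimately obtain x y where xy: "x \<in> X" "y \<in> X" "x \<noteq> y"
    and val: "\<And>k. k \<in> I \<Longrightarrow> valuation_ge (Ps ! fst k) (F k x - F k y) (int (m k))"
    using pigeonhole_valuations[of I X "\<lambda>k. Ps ! fst k" F m] fin_X place(2) I_n F_ring by blast
  \<comment> \<open>\<open>X\<close> need not be closed under subtraction, but each
    \<open>L j\<close> is, and membership in \<open>L j\<close> is all that the rest uses.\<close>
  define h where "h j = x j - y j" for j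
  have h_L: "h j \<in> L j" if "j \<in> {1..l}" for j
    using X_L[OF xy(1) that] X_L[OF xy(2) that] riemann_roch_diff by (simp add: h_def L_def)
  have H_h: "H h = H x - H y"
    by (simp add: H_def h_def flip: diff_monom sum_subtractf)
  have F_h: "F k x - F k y = F k h" for k
    by (auto simp: F_def Q_def H_h pcompose_diff h_def split: prod.splits)
  have coeff_H: "coeff (H h) j = (if j \<in> {1..l} then h j else 0)" for j
    by (simp add: H_def coeff_sum sum.delta)
  have H0: "H h \<noteq> 0"
  proof -
    obtain j where "j \<in> {1..l}" "x j \<noteq> y j"
      using xy PiE_ext[of x _ _ y] unfolding X_def by blast
    then have "coeff (H h) j \<noteq> 0" unfolding coeff_H by (simp add: h_def)
    then show ?thesis by auto
  qed
  have R0: "R h \<noteq> 0" unfolding R_def using H0 by (subst pcompose_eq_0_iff) auto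
  have Q0: "Q h \<noteq> 0" unfolding Q_R using R0 q by (subst pcompose_eq_0_iff) (auto simp: degree_monom_eq)
  have deg_R: "degree (R h) \<le> l"
  proof -
    have "degree (H h) \<le> l" using coeff_H by (intro degree_le) auto
    then show ?thesis by (simp add: R_def degree_pcompose)
  qed
  \<comment> \<open>Homogeneity: if f^q has weight q * G, then the coefficient of w^k in (w - f^q)^j
    has weight q * (j - k) * G. The difference is taken in the integers; for k > j the coefficient
    is 0.\<close>
  have lin_L: "coeff ([:(- f) ^ q, 1:] ^ j) k \<in> riemann_roch_space \<iota> (frag_cmul (int (q * j) - int (q * k)) G)" for j k
  proof (induction j arbitrary: k)
    case 0
    then show ?case by (auto simp: coeff_1 riemann_roch_zero riemann_roch_one)
  next
    case (Suc j)
    have "(- f) ^ q \<in> riemann_roch_space \<iota> (frag_cmul (int q) G)"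
      by (intro riemann_roch_power riemann_roch_uminus fG)
    from riemann_roch_mult[OF this Suc, of k]
    have a: "(- f) ^ q * coeff ([:(- f) ^ q, 1:] ^ j) k \<in> riemann_roch_space \<iota> (frag_cmul (int (q * Suc j) - int (q * k)) G)"
      by (simp add: algebra_simps flip: frag_cmul_distrib)
    show ?case
    proof (cases k)
      case 0
      then show ?thesis using a by simp
    next
      case (Suc k')
      have b: "coeff ([:(- f) ^ q, 1:] ^ j) k' \<in> riemann_roch_space \<iota> (frag_cmul (int (q * Suc j) - int (q * k)) G)"
        using Suc.IH[of k'] Suc by (simp add: algebra_simps)
      show ?thesis using riemann_roch_add[OF a b] Suc by simp
    qed
  qed
  \<comment> \<open>The weights cancel: L(A - q * j * G) times L(q * (j - k) * G) lies in L(A - q *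
    k * G), independently of j.\<close>
  have R_L: "coeff (R h) k \<in> L k" for k
  proof -
    have "coeff (R h) k = (\<Sum>j=1..l. h j * coeff ([:(- f) ^ q, 1:] ^ j) k)"
      by (simp add: R_def H_def pcompose_sum_monom coeff_sum)
    also have "\<dots> \<in> L k"
      unfolding L_def
    proof (rule riemann_roch_sum)
      fix j assume "j \<in> {1..l}"
      from riemann_roch_mult[OF h_L[OF this, unfolded L_def] lin_L[of j k]]
      show "h j * coeff ([:(- f) ^ q, 1:] ^ j) k \<in> riemann_roch_space \<iota> (A - frag_cmul (int (q * k)) G)"
        by (simp add: frag_cmul_diff_distrib algebra_simps)
    qed
    finally show ?thesis .
  qed
  have Q_sum: "Q h = (\<Sum>k\<le>l. monom (coeff (R h) k) (q * k))"
  proof -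
    have "R h = (\<Sum>k\<le>l. monom (coeff (R h) k) k)" using poly_as_sum_of_monoms'[OF deg_R] by simp
    then have "Q h = pcompose (\<Sum>k\<le>l. monom (coeff (R h) k) k) (monom 1 q)" using Q_R by simp
    also have "\<dots> = (\<Sum>k\<le>l. monom (coeff (R h) k) (q * k))"
      unfolding pcompose_sum_monom by (simp add: monom_power smult_monom)
    finally show ?thesis .
  qed
  have zero: "zero_with_multiplicity_ge \<iota> (Ps ! i) (r ! i) (Q h) (q * s)" if i: "i < n" for i
  proof (rule zero_with_multiplicity_geI[OF place(2)[OF i]])
    note P = place(1)[OF i]
    have h_ring: "valuation_ge (Ps ! i) (h j) 0" if "j \<in> {1..l}" for j
      using valuation_ge_0_iff[OF P] L_ring[OF i h_L[OF that]] by simp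
    have "pcompose (Q h) [:\<iota> (r ! i), 1:] \<in> point_ideal (Ps ! i) (q * s)"
    proof (cases "i \<in> E")
      case True
      \<comment> \<open>Three cases for b: exponents q * j with j < s are controlled by the
        pigeonhole conditions, multiples of q from q * s on only need integrality, and all other
        coefficients vanish.\<close>
      have "valuation_ge (Ps ! i) (coeff (pcompose (Q h) [:\<iota> (r ! i), 1:]) b) (int (q * s - b))" for b
      proof (cases "q dvd b \<and> b < q * s")
        case True': True
        then obtain j where j: "b = q * j" "j < s" using q by auto
        have "(i, j) \<in> I" using i True j by (simp add: I_def)
        from val[OF this, unfolded F_h] show ?thesis using True
          by (simp add: F_def m_def j right_diff_distrib')
      next
        case False
        show ?thesis
        proof (cases "q dvd b")
          case True
          then have "q * s - b = 0" using False by simp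
          then show ?thesis using shift_ring[OF i h_L] by (simp add: point_ideal_def)
        next
          case False
          then show ?thesis unfolding Q_shift_Frobenius using q by (simp add: coeff_pcompose_monom_one)
        qed
      qed
      then show ?thesis by (simp add: point_ideal_def)
    next
      case False
      then have "place_eval \<iota> (Ps ! i) f = r ! i" using i by (simp add: E_def codeword_def n_def)
      then have "f - \<iota> (r ! i) \<in> Ps ! i"
        using place_eval_residue[OF place(2)[OF i] f_ring[OF i]] by simp
      then have "- (f - \<iota> (r ! i)) \<in> Ps ! i" by (rule place_uminus[OF P])
      then have lin: "[:\<iota> (r ! i) - f, 1:] \<in> point_ideal (Ps ! i) 1"
        by (intro point_ideal_linear_1[OF P]) simp
      show ?thesis
        unfolding Q_shift_sum
      proof (rule point_ideal_sum[OF P])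
        fix j assume j: "j \<in> {1..l}"
        \<comment> \<open>Together with order q * j from (z - f)^(q * j) this reaches q * s. For j
          >= s the truncated bound is 0 and the second factor already suffices.\<close>
        have "valuation_ge (Ps ! i) (h j) (int (q * (s - j)))"
        proof (cases "j < s")
          case True
          then have "(i, j) \<in> I" using i False j by (simp add: I_def)
          from val[OF this, unfolded F_h] show ?thesis using False by (simp add: F_def m_def)
        next
          case False
          then show ?thesis using h_ring[OF j] by simp
        qed
        from point_ideal_smult[OF P this point_ideal_power[OF P lin, of "q * j"]]
        show "smult (h j) ([:\<iota> (r ! i) - f, 1:] ^ (q * j)) \<in> point_ideal (Ps ! i) (q * s)"
          by (rule point_ideal_mono[rotated], simp flip: distrib_left, arith)
      qed
    qed
    then show "valuation_ge (Ps ! i) (coeff (pcompose (Q h) [:\<iota> (r ! i), 1:]) b) (int (q * s - b))" for b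
      by (simp add: point_ideal_def)
  qed
  show ?thesis
    unfolding interpolation_polynomial_def
    using Q0 Q_sum R_L zero unfolding L_def n_def q_def by blast
qed

section \<open>The decoding radius\<close>

lemma list_decoding_radius_bound:
  fixes g s l e :: nat
  assumes g: "has_genus \<iota> g" and distinct: "distinct Ps" and rational: "\<forall>P\<in>set Ps. rational_place \<iota> P"
    and G: "divisor \<iota> G" "disjoint_support G (sum_of_places Ps)"
    and s: "1 \<le> s" "s \<le> l"
  shows "list_decoding_radius_ge \<iota> Ps G s l e
            ((real s * (2 * real l - real s + 1) * real (length Ps)
                - real l * (real l + 1) * real_of_int (divisor_degree \<iota> G))
               / (2 * real s * (real l + 1))
             - (1 + real g * real l) / (real CHAR('q) ^ e * real s * (real l + 1)))"
  unfolding list_decoding_radius_ge_def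
proof (intro allI impI)
  fix \<tau> r A S
  define n where "n = length Ps"
  define q where "q = CHAR('q) ^ e"
  define dG where "dG = divisor_degree \<iota> G"
  assume \<tau>: "\<tau> \<le> length Ps"
    "real \<tau> \<le> ((real s * (2 * real l - real s + 1) * real (length Ps)
                - real l * (real l + 1) * real_of_int (divisor_degree \<iota> G))
               / (2 * real s * (real l + 1))
             - (1 + real g * real l) / (real CHAR('q) ^ e * real s * (real l + 1)))"
    and len: "length r = length Ps" and A: "admissible_divisor \<iota> Ps s e \<tau> A"
    and S: "decoder_output \<iota> Ps G s l e \<tau> A r S"
  have q0: "0 < q" using prime_gt_0_nat[OF prime_CHAR_constants] by (simp add: q_def)
  have "real \<tau> * (2 * real q * real s * (real l + 1)) \<le>
     ((real s * (2 * real l - real s + 1) * real n - real l * (real l + 1) * real_of_int dG)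
               / (2 * real s * (real l + 1))
             - (1 + real g * real l) / (real q * real s * (real l + 1))) * (2 * real q * real s * (real l + 1))"
    using \<tau>(2) unfolding n_def q_def dG_def by (intro mult_right_mono) auto
  also have "\<dots> = real q * (real s * (2 * real l - real s + 1) * real n - real l * (real l + 1) * real_of_int dG)
      - 2 * (1 + real g * real l)"
  proof -
    have *: "(a / (2 * b * c) - d / (p * b * c)) * (2 * p * b * c) = p * a - 2 * d"
      if "b \<noteq> 0" "c \<noteq> 0" "p \<noteq> 0" for a b c d p :: real
      using that by (simp add: field_simps)
    show ?thesis using q0 s(1) by (intro *) auto
  qed
  finally have "real_of_int (int \<tau> * (2 * int q * int s * (int l + 1))) \<le>
      real_of_int (int q * (int s * (2 * int l - int s + 1) * int n - int l * (int l + 1) * dG)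
        - 2 * (1 + int g * int l))"
    by simp
  then have "int \<tau> * (2 * int q * int s * (int l + 1)) \<le>
      int q * (int s * (2 * int l - int s + 1) * int n - int l * (int l + 1) * dG)
        - 2 * (1 + int g * int l)"
    by (simp only: of_int_le_iff)
  \<comment> \<open>Multiplying by 2 * q * s * (l + 1) left a subtracted 2 * (1 + g * l), whereas
    the count subtracts 2 * g * l. The surplus 2 turns <= into the strict inequality of the
    pigeonhole.\<close>
  then have bound: "int q * (int n * int s * (int s - 1) + 2 * int s * int \<tau>) <
      2 * int l * (int q * int s * (int n - int \<tau>) - int g) - int q * int l * (int l + 1) * dG"
    by (simp add: algebra_simps)
  show "S = close_functions \<iota> Ps G \<tau> r \<and> finite S \<and> card S \<le> l"
  proof (cases "\<exists>Q. interpolation_polynomial \<iota> Ps G s l e A r Q")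
    case True
    then obtain Q where Q: "interpolation_polynomial \<iota> Ps G s l e A r Q"
        "S = {f \<in> close_functions \<iota> Ps G \<tau> r. poly Q f = 0}"
      using S unfolding decoder_output_def by auto
    have "S = close_functions \<iota> Ps G \<tau> r"
      using interpolation_polynomial_root[OF g distinct rational G(2) len A Q(1)] Q(2) by blast
    moreover have "S \<subseteq> {f. poly Q f = 0}" using Q(2) by blast
    ultimately show ?thesis
      using interpolation_polynomial_roots_card[OF Q(1)] by (meson card_mono finite_subset le_trans)
  next
    \<comment> \<open>Any close f would yield an interpolation polynomial, so without one the empty
      list is the correct answer.\<close>
    case False
    then have "close_functions \<iota> Ps G \<tau> r = {}"
      using interpolation_polynomial_exists[OF g rational G len A _ s] bound
      unfolding n_def q_def dG_def by blast
    then show ?thesis using S False by (simp add: decoder_output_def)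
  qed
qed

end

lemma list_decoding_radius_ge_mono:
  assumes "list_decoding_radius_ge \<iota> Ps G s l e X" and "Y \<le> X"
  shows "list_decoding_radius_ge \<iota> Ps G s l e Y"
  using assms unfolding list_decoding_radius_ge_def by (meson order_trans)

theorem corollary6:
  fixes \<iota> :: "'q::{field,finite} \<Rightarrow> 'f::field"
    and g p n s l :: nat
    and Ps :: "'f set list"
    and G :: "'f set \<Rightarrow>\<^sub>0 int"
  assumes "function_field \<iota>" and "full_constant_field \<iota>"
    and "has_genus \<iota> g"
    and "p = CHAR('q)"
    and "n = length Ps" and "distinct Ps" and "\<forall>P\<in>set Ps. rational_place \<iota> P"
    and "divisor \<iota> G" and "disjoint_support G (sum_of_places Ps)"
    and "1 \<le> s" and "s \<le> l"
  shows "(\<forall>e::nat. list_decoding_radius_ge \<iota> Ps G s l e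
            ((real s * (2 * real l - real s + 1) * real n
                - real l * (real l + 1) * real_of_int (divisor_degree \<iota> G))
               / (2 * real s * (real l + 1))
             - (1 + real g * real l) / (real p ^ e * real s * (real l + 1)))) \<and>
         list_decoding_radius_ge \<iota> Ps G s l (nat \<lceil>log (real p) (1 + real g * real l)\<rceil>)
            ((real s * (2 * real l - real s + 1) * real n
                - real l * (real l + 1) * real_of_int (divisor_degree \<iota> G) - 2)
               / (2 * real s * (real l + 1)))"
proof (intro conjI allI)
  interpret function_field \<iota> by fact
  define e where "e = nat \<lceil>log (real p) (1 + real g * real l)\<rceil>"
  define a where "a = real s * (2 * real l - real s + 1) * real n
    - real l * (real l + 1) * real_of_int (divisor_degree \<iota> G)"
  show bound: "list_decoding_radius_ge \<iota> Ps G s l e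
            ((real s * (2 * real l - real s + 1) * real n
                - real l * (real l + 1) * real_of_int (divisor_degree \<iota> G))
               / (2 * real s * (real l + 1))
             - (1 + real g * real l) / (real p ^ e * real s * (real l + 1)))" for e
    using list_decoding_radius_bound[OF assms(3,6-11), of e] assms(4,5) by simp
  have p: "1 < real p" using prime_gt_1_nat[OF prime_CHAR_constants] assms(4) by simp
  \<comment> \<open>The choice of e gives 1 + g * l <= p^e, so the subtracted fraction is at most 1
    / (s * (l + 1)). Over the common denominator 2 * s * (l + 1) this is the 2 in the second
    bound.\<close>
  have "1 + real g * real l = real p powr log (real p) (1 + real g * real l)"
    using p by (intro powr_log_cancel[symmetric]) (auto simp: add_pos_nonneg)
  also have "\<dots> \<le> real p powr real e"
    using p unfolding e_def by (intro powr_mono) (auto intro: real_nat_ceiling_ge)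
  also have "\<dots> = real p ^ e" using p by (simp add: powr_realpow)
  finally have "(1 + real g * real l) / (real p ^ e * real s * (real l + 1))
      \<le> real p ^ e / (real p ^ e * real s * (real l + 1))"
    by (intro divide_right_mono) auto
  also have "\<dots> = 2 / (2 * real s * (real l + 1))" using p by simp
  finally have "(a - 2) / (2 * real s * (real l + 1)) \<le>
      a / (2 * real s * (real l + 1)) - (1 + real g * real l) / (real p ^ e * real s * (real l + 1))"
    by (simp add: diff_divide_distrib)
  then show "list_decoding_radius_ge \<iota> Ps G s l e
     ((real s * (2 * real l - real s + 1) * real n
       - real l * (real l + 1) * real_of_int (divisor_degree \<iota> G) - 2) / (2 * real s * (real l + 1)))"
    using list_decoding_radius_ge_mono[OF bound] by (simp only: a_def)
qed

end
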